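(* Let $\mathcal H=\{h:\mathbb R^{\Lambda}\to\{0,1\}^{\Lambda}\mid h(x)=\mathbf 1_{\Lambda'}\text{ for all }x,\ \Lambda'\subseteq\Lambda\}$ be the family of all deterministic subset selections, and let $$h^\star=\arg\min_{h\in\mathcal H}\Big\{\|\hat f(h)-\tilde f\|^2+2\,Pen(h)\Big\}.$$ Then, as $n\to\infty$, uniformly over $f\in\mathcal F_0(\gamma_n)$, $$\mathbf E_f\|\hat f(h^\star)-f\|^2\le(4+o(1))\,\|\Sigma_{h^f}\|\Big(n\gamma_n\log(\gamma_n^{-1})+\log(n\gamma_n)\log_+(n\|\Sigma\|)\Big)+4\sqrt2\,\min\big(\tfrac1n,\|\Sigma\|\big).$$ In particular, if $\log_+(\|\Sigma\|)=O(\log n)$ and $\frac{\|\Sigma_{h^f}\|}{\|\Sigma\|}\max(n\|\Sigma\|,1)\,n\gamma_n\log(\gamma_n^{-1})\to\infty$ (for a sequence $f=f^{(n)}\in\mathcal F_0(\gamma_n)$), then $$\mathbf E_f\|\hat f(h^\star)-f\|^2\le(4+o(1))\,\|\Sigma_{h^f}\|\,n\gamma_n\log(\gamma_n^{-1}).$$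
   Context: For each $n$, let $\Lambda=\Lambda_n$ be a finite index set with $\#\Lambda=n$. One observes $X_\lambda=f_\lambda+\xi_\lambda$, $\lambda\in\Lambda$, where $(f_\lambda)\in\mathbb R^\Lambda$ is unknown and deterministic and $(\xi_\lambda)_{\lambda\in\Lambda}\sim\mathcal N(0,\Sigma)$ with $\Sigma=\mathrm{diag}(\sigma_\lambda^2)_{\lambda\in\Lambda}$, $\sigma_\lambda>0$ (the $\sigma_\lambda$ may depend on $n$). Write $X=(X_\lambda)_\lambda$; $\mathbf E_f$ is expectation when the true parameter is $f$. $\|\Sigma\|=\max_\lambda\sigma_\lambda^2$ is the operator norm. Let $(\psi_\lambda)_{\lambda\in\Lambda}$ be an orthonormal system in $L^2$, $f=\sum_{\lambda\in\Lambda}f_\lambda\psi_\lambda$, $\tilde f=\sum_{\lambda\in\Lambda}X_\lambda\psi_\lambda$, and for $h\in\{0,1\}^\Lambda$ let $\hat f(h)=\sum_{\lambda\in\Lambda}h_\lambda X_\lambda\psi_\lambda$. Norms of functions are $L^2$ norms, i.e. Euclidean norms of coefficient vectors. For $h\in\{0,1\}^\Lambda$ let $|h|=\#\{\lambda:h_\lambda=1\}$, and $$Pen(h)=2\sum_{j=1}^{|h|}\sigma_{(j)_h}^2\Big(\log(ne/j)+j^{-1}\log_+(n\|\Sigma\|)\Big),$$ where $\sigma_{(j)_h}^2$ is the $j$-th largest value among $\{h_\lambda\sigma_\lambda^2\}$ and $\log_+(z)=\max(\log z,0)$. For each realization of the data, $h^\star$ is a (measurably chosen) minimizer over the finite family $\mathcal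 H$, identified with $\{0,1\}^\Lambda$; $\hat f(h^\star)$ uses the value $h^\star(X)$. Sparsity class: $\mathcal F_0(\gamma_n)=\{f:\sum_{\lambda\in\Lambda}\mathbf 1(f_\lambda\ne0)\le n\gamma_n\}$, where $\gamma_n\in(0,1)$ satisfies $\gamma_n\to0$ and $n\gamma_n\to\infty$ as $n\to\infty$. For $f$ let $h^f\in\{0,1\}^\Lambda$ be $h^f_\lambda=\mathbf 1(f_\lambda\ne0)$; for $h\in\{0,1\}^\Lambda$, $\Sigma_h=\mathrm{diag}(\sigma_\lambda^2)_{\lambda:h_\lambda=1}$, so $\|\Sigma_{h^f}\|=\max\{\sigma_\lambda^2:f_\lambda\ne0\}$ ($=0$ if $f=0$). "$o(1)$ uniformly over $f\in\mathcal F_0(\gamma_n)$" means a sequence tending to $0$ as $n\to\infty$ that does not depend on $f\in\mathcal F_0(\gamma_n)$. *)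

theory Defs
  imports "HOL-Probability.Probability" "HOL-Library.Landau_Symbols"
begin

text \<open>Vectors in \<open>\<real>\<^sup>\<Lambda>\<close> are functions \<open>'i \<Rightarrow> real\<close> of which only the values on \<open>\<Lambda>\<close> matter.\<close>

definition log_plus :: "real \<Rightarrow> real" where
  "log_plus z = max (ln z) 0"


subsection \<open>Gaussian sequence model\<close>

text \<open>The law \<open>N(0, diag(\<sigma>\<^sub>\<lambda>\<^sup>2))\<close>; the second argument of \<^const>\<open>normal_density\<close> is the
  standard deviation.\<close>

definition noise :: "'i set \<Rightarrow> ('i \<Rightarrow> real) \<Rightarrow> ('i \<Rightarrow> real) measure" where
  "noise \<Lambda> \<sigma> = PiM \<Lambda> (\<lambda>i. density lborel (\<lambda>x. ennreal (normal_density 0 (\<sigma> i) x)))"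

definition observation :: "'i set \<Rightarrow> ('i \<Rightarrow> real) \<Rightarrow> ('i \<Rightarrow> real) \<Rightarrow> 'i \<Rightarrow> real" where
  "observation \<Lambda> f \<xi> = (\<lambda>i\<in>\<Lambda>. f i + \<xi> i)"

text \<open>\<open>expect \<Lambda> \<sigma> f g\<close> is \<open>E\<^sub>f g(X)\<close>.\<close>

definition expect ::
  "'i set \<Rightarrow> ('i \<Rightarrow> real) \<Rightarrow> ('i \<Rightarrow> real) \<Rightarrow> (('i \<Rightarrow> real) \<Rightarrow> real) \<Rightarrow> real" where
  "expect \<Lambda> \<sigma> f g = (\<integral>\<xi>. g (observation \<Lambda> f \<xi>) \<partial>(noise \<Lambda> \<sigma>))"


subsection \<open>Functions in \<open>L\<^sup>2\<close>\<close>

definition L2_norm :: "'x measure \<Rightarrow> ('x \<Rightarrow> real) \<Rightarrow> real" where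
  "L2_norm \<mu> g = sqrt (\<integral>t. (g t)\<^sup>2 \<partial>\<mu>)"

definition orthonormal_system :: "'x measure \<Rightarrow> 'i set \<Rightarrow> ('i \<Rightarrow> 'x \<Rightarrow> real) \<Rightarrow> bool" where
  "orthonormal_system \<mu> \<Lambda> \<psi> \<longleftrightarrow>
     (\<forall>i\<in>\<Lambda>. \<psi> i \<in> borel_measurable \<mu> \<and> integrable \<mu> (\<lambda>t. (\<psi> i t)\<^sup>2)) \<and>
     (\<forall>i\<in>\<Lambda>. \<forall>j\<in>\<Lambda>. (\<integral>t. \<psi> i t * \<psi> j t \<partial>\<mu>) = (if i = j then 1 else 0))"

definition series :: "'i set \<Rightarrow> ('i \<Rightarrow> 'x \<Rightarrow> real) \<Rightarrow> ('i \<Rightarrow> real) \<Rightarrow> 'x \<Rightarrow> real" where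
  "series \<Lambda> \<psi> c = (\<lambda>t. \<Sum>i\<in>\<Lambda>. c i * \<psi> i t)"

text \<open>\<open>f_hat \<Lambda> \<psi> x h\<close> is the projection estimator \<open>\<Sum> h\<^sub>\<lambda> x\<^sub>\<lambda> \<psi>\<^sub>\<lambda>\<close> for the data \<open>x\<close>.\<close>

definition f_hat ::
  "'i set \<Rightarrow> ('i \<Rightarrow> 'x \<Rightarrow> real) \<Rightarrow> ('i \<Rightarrow> real) \<Rightarrow> ('i \<Rightarrow> real) \<Rightarrow> 'x \<Rightarrow> real" where
  "f_hat \<Lambda> \<psi> x h = series \<Lambda> \<psi> (\<lambda>i. h i * x i)"


subsection \<open>Penalty and subset selection\<close>

definition support :: "'i set \<Rightarrow> ('i \<Rightarrow> real) \<Rightarrow> 'i set" where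
  "support \<Lambda> h = {i \<in> \<Lambda>. h i = 1}"

text \<open>Operator norm of \<open>diag(\<sigma>\<^sub>\<lambda>\<^sup>2)\<^bsub>\<lambda>\<in>S\<^esub>\<close>; the \<open>0\<close> only matters for \<open>S = {}\<close>.\<close>

definition diag_norm :: "('i \<Rightarrow> real) \<Rightarrow> 'i set \<Rightarrow> real" where
  "diag_norm \<sigma> S = Max (insert 0 ((\<lambda>i. (\<sigma> i)\<^sup>2) ` S))"

text \<open>The \<open>j\<close>-th largest (counted with multiplicity, \<open>j = 1, \<dots>, card \<Lambda>\<close>) of the
  \<open>h\<^sub>\<lambda> \<sigma>\<^sub>\<lambda>\<^sup>2\<close>.\<close>

definition sigma2_ord :: "'i set \<Rightarrow> ('i \<Rightarrow> real) \<Rightarrow> ('i \<Rightarrow> real) \<Rightarrow> nat \<Rightarrow> real" where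
  "sigma2_ord \<Lambda> \<sigma> h j =
     rev (sorted_list_of_multiset (image_mset (\<lambda>i. h i * (\<sigma> i)\<^sup>2) (mset_set \<Lambda>))) ! (j - 1)"

definition Pen :: "'i set \<Rightarrow> ('i \<Rightarrow> real) \<Rightarrow> ('i \<Rightarrow> real) \<Rightarrow> real" where
  "Pen \<Lambda> \<sigma> h =
     2 * (\<Sum>j = 1..card (support \<Lambda> h).
            sigma2_ord \<Lambda> \<sigma> h j *
              (ln (real (card \<Lambda>) * exp 1 / real j)
               + 1 / real j * log_plus (real (card \<Lambda>) * diag_norm \<sigma> \<Lambda>)))"

definition criterion ::
  "'x measure \<Rightarrow> 'i set \<Rightarrow> ('i \<Rightarrow> 'x \<Rightarrow> real) \<Rightarrow> ('i \<Rightarrow> real) \<Rightarrow> ('i \<Rightarrow> real) \<Rightarrow> ('i \<Rightarrow> real) \<Rightarrow> real" where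
  "criterion \<mu> \<Lambda> \<psi> \<sigma> x h =
     (L2_norm \<mu> (\<lambda>t. f_hat \<Lambda> \<psi> x h t - series \<Lambda> \<psi> x t))\<^sup>2 + 2 * Pen \<Lambda> \<sigma> h"

definition binary_vectors :: "'i set \<Rightarrow> ('i \<Rightarrow> real) set" where
  "binary_vectors \<Lambda> = (\<Pi>\<^sub>E i\<in>\<Lambda>. {0, 1})"

text \<open>Deterministic subset selections, as constant maps from the data to binary vectors.\<close>

definition subset_selections :: "'i set \<Rightarrow> (('i \<Rightarrow> real) \<Rightarrow> ('i \<Rightarrow> real)) set" where
  "subset_selections \<Lambda> = {(\<lambda>x. restrict (indicator \<Lambda>') \<Lambda>) | \<Lambda>'. \<Lambda>' \<subseteq> \<Lambda>}"

text \<open>\<open>h\<close> is the data-dependent value of a minimizer: for every data point \<open>x\<close> some member of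
  the family minimizes the criterion at \<open>x\<close>, and \<open>h x\<close> is the value of that member at \<open>x\<close>.
  Ties may be broken in any measurable way.\<close>

definition penalized_selector ::
  "'x measure \<Rightarrow> 'i set \<Rightarrow> ('i \<Rightarrow> 'x \<Rightarrow> real) \<Rightarrow> ('i \<Rightarrow> real) \<Rightarrow> (('i \<Rightarrow> real) \<Rightarrow> ('i \<Rightarrow> real)) \<Rightarrow> bool" where
  "penalized_selector \<mu> \<Lambda> \<psi> \<sigma> h \<longleftrightarrow>
     h \<in> measurable (PiM \<Lambda> (\<lambda>_. borel)) (count_space (binary_vectors \<Lambda>)) \<and>
     (\<forall>x \<in> \<Lambda> \<rightarrow>\<^sub>E UNIV. \<exists>g. is_arg_min (\<lambda>g. criterion \<mu> \<Lambda> \<psi> \<sigma> x (g x))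
                                 (\<lambda>g. g \<in> subset_selections \<Lambda>) g \<and> h x = g x)"


subsection \<open>Sparsity and risk\<close>

definition sparse_class :: "'i set \<Rightarrow> real \<Rightarrow> ('i \<Rightarrow> real) set" where
  "sparse_class \<Lambda> \<gamma> = {f. (\<Sum>i\<in>\<Lambda>. of_bool (f i \<noteq> 0)) \<le> real (card \<Lambda>) * \<gamma>}"

definition nonzero_indicator :: "('i \<Rightarrow> real) \<Rightarrow> 'i \<Rightarrow> real" where
  "nonzero_indicator f = (\<lambda>i. of_bool (f i \<noteq> 0))"

text \<open>The quadratic risk \<open>E\<^sub>f \<parallel>f_hat(h(X)) - f\<parallel>\<^sup>2\<close>; the integrand is integrable whenever
  \<open>h\<close> is a \<^const>\<open>penalized_selector\<close>, the \<open>\<sigma>\<^sub>\<lambda>\<close> are positive and \<open>\<psi>\<close> is orthonormal.\<close>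

definition risk ::
  "'x measure \<Rightarrow> 'i set \<Rightarrow> ('i \<Rightarrow> 'x \<Rightarrow> real) \<Rightarrow> ('i \<Rightarrow> real) \<Rightarrow> (('i \<Rightarrow> real) \<Rightarrow> ('i \<Rightarrow> real)) \<Rightarrow>
   ('i \<Rightarrow> real) \<Rightarrow> real" where
  "risk \<mu> \<Lambda> \<psi> \<sigma> h f =
     expect \<Lambda> \<sigma> f (\<lambda>x. (L2_norm \<mu> (\<lambda>t. f_hat \<Lambda> \<psi> x (h x) t - series \<Lambda> \<psi> f t))\<^sup>2)"

end

theory Submission
  imports Defs "HOL-Real_Asymp.Real_Asymp"
begin

text \<open>
Let \<open>S\<close> be the support of \<open>f\<close> and \<open>T\<close> the selected set. Comparing the criterion at \<open>T\<close> with its value at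
\<open>S\<close> gives, for every \<open>0 < \<delta> < 1\<close>, the pointwise bound
  \<open>(1 - \<delta>) * loss \<le> 2 * Pen S + (\<Sum>i\<in>S. (\<xi> i)\<^sup>2) / \<delta> + 2 * ((\<Sum>i\<in>T. (\<xi> i)\<^sup>2) - Pen T)\<close>
(\<open>selected_loss_le\<close>). For \<open>f\<close> with at most \<open>x = n * \<gamma>\<close> nonzero coefficients, \<open>2 * Pen S\<close> is the main term with
the constant \<open>4\<close> (\<open>sum_threshold_le\<close>), and the middle term is of smaller order if \<open>\<delta>\<close> tends to \<open>0\<close> more slowly
than \<open>1 / ln (1 / \<gamma>)\<close>.

The last term must be bounded uniformly over all \<open>T\<close>, and with a constant strictly below \<open>4 * sqrt 2\<close>,
since the factor \<open>1 / (1 - \<delta>)\<close> has to fit as well. Write \<open>c j\<close> for twice the bracket in the penalty and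
\<open>w i\<close> for the squared standardized noise. Abel summation over the ordered variances reduces the term to
\<open>diag_norm \<sigma> \<Lambda>\<close> times the largest value of \<open>(\<Sum>i\<in>A. w i) - (\<Sum>j = 1..card A. c j)\<close>. This in turn is at most
the sum, over all nonempty \<open>B \<subseteq> \<Lambda>\<close>, of the amount by which all \<open>w i\<close> with \<open>i \<in> B\<close> exceed \<open>c (card B)\<close>
(\<open>noise_energy_minus_Pen_le\<close>).

The minimum of \<open>k\<close> numbers is at most their geometric mean, so each of these amounts is dominated by a
product over \<open>B\<close> of functions of single coordinates. These functions have Gaussian expectation at most
\<open>q * exp (- c k / 2)\<close> with \<open>q < 1\<close>, by an estimate in the manner of Mills' ratio. The thresholds cancel the number
of sets \<open>B\<close> of each size, and what remains is a geometric series times \<open>exp (- L)\<close>, where \<open>L\<close> is the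
\<open>log_plus\<close> term of the penalty (\<open>nn_integral_overshoot_le\<close>). Its total is small enough to give the constant
\<open>11 / 2 < 4 * sqrt 2\<close> in \<open>oracle_risk_le\<close>.

For the second claim, the growth assumption gives \<open>L = O(ln n)\<close>, and \<open>ln n = ln x + ln (1 / \<gamma>)\<close> then shows
that \<open>ln x * L\<close> is negligible against \<open>x * ln (1 / \<gamma>)\<close>; the divergence assumption says precisely that
the remainder is negligible against the main term.
\<close>

section \<open>Exceedances of order statistics\<close>

text \<open>For \<open>w \<ge> c\<close> this is the tangent line at \<open>(w - c) / 2 = 1\<close> to the \<open>k\<close>-th root of \<open>(w - c) / 2\<close>,
and it is cut off to \<open>0\<close> below \<open>c\<close>. Like the root, it lets a product of \<open>k\<close> independent factors
dominate the amount by which all \<open>k\<close> variables exceed \<open>c\<close>; being affine in \<open>w\<close>, it has a Gaussian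
expectation with an explicit antiderivative.\<close>

definition excess :: "nat \<Rightarrow> real \<Rightarrow> real \<Rightarrow> real" where
  "excess k c w = (if c \<le> w then 1 + ((w - c) / 2 - 1) / real k else 0)"

definition overshoot :: "'i set \<Rightarrow> (nat \<Rightarrow> real) \<Rightarrow> ('i \<Rightarrow> real) \<Rightarrow> real" where
  "overshoot \<Lambda> c w =
     (\<Sum>A \<in> Pow \<Lambda> - {{}}. 2 * (\<Prod>i\<in>A. excess (card A) (c (card A)) (w i)))"

lemma excess_nonneg: "1 \<le> k \<Longrightarrow> 0 \<le> excess k c w"
  by (auto simp: excess_def field_simps)

lemma excess_prod_nonneg:
  assumes "finite \<Lambda>" "A \<in> Pow \<Lambda> - {{}}"
  shows "0 \<le> (\<Prod>i\<in>A. excess (card A) (c (card A)) (w i))"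
proof -
  have "finite A" "A \<noteq> {}"
    using assms by (auto intro: finite_subset)
  then have "1 \<le> card A"
    by (simp add: card_gt_0_iff Suc_le_eq)
  then show ?thesis
    by (intro prod_nonneg) (auto intro: excess_nonneg)
qed

lemma overshoot_nonneg: "finite \<Lambda> \<Longrightarrow> 0 \<le> overshoot \<Lambda> c w"
  unfolding overshoot_def
  by (intro sum_nonneg mult_nonneg_nonneg excess_prod_nonneg) auto

lemma overshoot_mono:
  assumes "finite \<Lambda>" "B \<subseteq> \<Lambda>"
  shows "overshoot B c w \<le> overshoot \<Lambda> c w"
  unfolding overshoot_def
  by (rule sum_mono2) (use assms excess_prod_nonneg[OF assms(1)] in \<open>auto\<close>)

text \<open>The lower bound \<open>m\<close> is the smallest of the \<open>w i\<close>. Each factor is at least \<open>1 + (v - 1) / k\<close> with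
\<open>v = (m - c) / 2\<close>, and Bernoulli's inequality turns the \<open>k\<close>-th power of this into \<open>v\<close>.\<close>

lemma minus_threshold_le_prod_excess:
  assumes "finite A" "A \<noteq> {}" and m: "\<And>i. i \<in> A \<Longrightarrow> m \<le> w i"
  shows "m - c \<le> 2 * (\<Prod>i\<in>A. excess (card A) c (w i))"
proof -
  have k: "1 \<le> card A"
    using assms by (simp add: card_gt_0_iff Suc_le_eq)
  show ?thesis
  proof (cases "c \<le> m")
    case False
    have "0 \<le> (\<Prod>i\<in>A. excess (card A) c (w i))"
      by (intro prod_nonneg) (auto intro: excess_nonneg[OF k])
    with False show ?thesis
      by linarith
  next
    case True
    define v where "v = (m - c) / 2"
    have v: "- 1 \<le> (v - 1) / real (card A)"
      using True k by (simp add: v_def field_simps)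
    have "v = 1 + real (card A) * ((v - 1) / real (card A))"
      using k by simp
    also have "\<dots> \<le> (1 + (v - 1) / real (card A)) ^ card A"
      using v by (rule Bernoulli_inequality)
    also have "\<dots> = (\<Prod>i\<in>A. 1 + (v - 1) / real (card A))"
      by simp
    also have "\<dots> \<le> (\<Prod>i\<in>A. excess (card A) c (w i))"
    proof (rule prod_mono, intro conjI)
      fix i assume "i \<in> A"
      show "0 \<le> 1 + (v - 1) / real (card A)"
        using v by simp
      show "1 + (v - 1) / real (card A) \<le> excess (card A) c (w i)"
        using True m[OF \<open>i \<in> A\<close>] k
        by (auto simp: excess_def v_def intro!: divide_right_mono)
    qed
    finally show ?thesis
      by (simp add: v_def)
  qed
qed

text \<open>Remove an index \<open>x\<close> with the smallest value from \<open>A\<close>. The largest threshold index \<open>card A\<close> is paired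
with \<open>w x\<close>, and \<open>w x - c (card A)\<close> is paid for by the summand of the overshoot that belongs to \<open>A\<close>
itself; the summands for smaller sets remain for the other indices. Thus the order statistics of
\<open>w\<close> are controlled by a union bound over all subsets.\<close>

lemma sum_minus_thresholds_le_overshoot:
  assumes "finite A"
  shows "(\<Sum>i\<in>A. w i) - (\<Sum>j = 1..card A. c j) \<le> overshoot A c w"
  using assms
proof (induction rule: finite_ranking_induct[where f = "\<lambda>i. - w i"])
  case empty
  show ?case
    by (simp add: overshoot_def)
next
  case (insert x S)
  show ?case
  proof (cases "x \<in> S")
    case True
    with insert.IH show ?thesis
      by (simp add: insert_absorb)
  next
    case False
    define A where "A = insert x S"
    have fin: "finite A" and card: "card A = Suc (card S)"
      using insert.hyps False by (auto simp: A_def)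
    let ?t = "\<lambda>B. 2 * (\<Prod>i\<in>B. excess (card B) (c (card B)) (w i))"
    have "overshoot S c w + ?t A = sum ?t (insert A (Pow S - {{}}))"
      using False insert.hyps by (subst sum.insert) (auto simp: overshoot_def A_def)
    also have "\<dots> \<le> overshoot A c w"
      unfolding overshoot_def
      by (rule sum_mono2) (use fin excess_prod_nonneg[OF fin] in \<open>auto simp: A_def\<close>)
    finally have le: "overshoot S c w + ?t A \<le> overshoot A c w" .
    have "w x - c (card A) \<le> ?t A"
      using insert.hyps fin by (intro minus_threshold_le_prod_excess) (auto simp: A_def)
    moreover have "sum w A = w x + sum w S"
      using insert.hyps False by (simp add: A_def)
    moreover have "(\<Sum>j = 1..card A. c j) = (\<Sum>j = 1..card S. c j) + c (card A)"
      by (simp add: card)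
    ultimately show ?thesis
      using le insert.IH by (simp add: A_def)
  qed
qed

text \<open>Abel summation: a decreasing nonnegative weight turns the weighted sum into a nonnegative
combination of partial sums with total weight \<open>s 0\<close>.\<close>

lemma weighted_sum_le_of_partial_sums:
  fixes s d :: "nat \<Rightarrow> real"
  assumes dec: "\<And>j. Suc j < k \<Longrightarrow> s (Suc j) \<le> s j"
    and nonneg: "\<And>j. j < k \<Longrightarrow> 0 \<le> s j"
    and part: "\<And>m. m \<le> k \<Longrightarrow> (\<Sum>j<m. d j) \<le> B"
    and M: "\<And>j. j < k \<Longrightarrow> s j \<le> M" "0 \<le> M"
  shows "(\<Sum>j<k. s j * d j) \<le> M * B"
proof -
  have B: "0 \<le> B"
    using part[of 0] by simp
  have *: "(\<Sum>j<Suc m. s j * d j) \<le> (s 0 - s m) * B + s m * (\<Sum>j<Suc m. d j)" if "m < k" for m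
    using that
  proof (induction m)
    case (Suc m)
    let ?D = "\<Sum>j<Suc m. d j"
    have "(\<Sum>j<Suc (Suc m). s j * d j)
        \<le> (s 0 - s m) * B + s m * ?D + s (Suc m) * d (Suc m)"
      using Suc by simp
    also have "\<dots> = (s 0 - s m) * B + (s m - s (Suc m)) * ?D + s (Suc m) * (?D + d (Suc m))"
      by (simp add: algebra_simps)
    also have "\<dots> \<le> (s 0 - s m) * B + (s m - s (Suc m)) * B + s (Suc m) * (?D + d (Suc m))"
      using mult_left_mono[OF part[of "Suc m"], of "s m - s (Suc m)"] Suc.prems dec[of m]
      by simp
    finally show ?case
      by (simp add: algebra_simps)
  qed simp
  show ?thesis
  proof (cases k)
    case 0
    then show ?thesis
      using B M by simp
  next
    case (Suc m)
    have "(\<Sum>j<k. s j * d j) \<le> (s 0 - s m) * B + s m * (\<Sum>j<k. d j)"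
      using *[of m] Suc by simp
    also have "\<dots> \<le> (s 0 - s m) * B + s m * B"
      using mult_left_mono[OF part[of k], of "s m"] Suc nonneg[of m] by simp
    also have "\<dots> = s 0 * B"
      by (simp add: algebra_simps)
    also have "\<dots> \<le> M * B"
      using Suc M(1)[of 0] B by (intro mult_right_mono) auto
    finally show ?thesis .
  qed
qed

section \<open>Noise energy against the penalty\<close>

lemma diag_norm_ge: "finite S \<Longrightarrow> i \<in> S \<Longrightarrow> (\<sigma> i)\<^sup>2 \<le> diag_norm \<sigma> S"
  by (auto simp: diag_norm_def)

lemma diag_norm_nonneg: "finite S \<Longrightarrow> 0 \<le> diag_norm \<sigma> S"
  by (auto simp: diag_norm_def)

text \<open>Twice the bracket in the penalty: the level that the \<open>j\<close>-th largest squared standardized noise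
variable rarely exceeds.\<close>

definition threshold :: "nat \<Rightarrow> real \<Rightarrow> nat \<Rightarrow> real" where
  "threshold n L j = 2 * (ln (real n * exp 1 / real j) + 1 / real j * L)"

text \<open>The zeros that \<open>h\<close> produces off \<open>T\<close> come after all the positive values \<open>(\<sigma> i)\<^sup>2\<close> with \<open>i \<in> T\<close>, so the
first \<open>card T\<close> ordered values are those of \<open>T\<close> in decreasing order. The enumeration makes the penalty a
sum over the indices themselves.\<close>

lemma sigma2_ord_enumeration:
  assumes fin: "finite \<Lambda>" and T: "T \<subseteq> \<Lambda>" and pos: "\<And>i. i \<in> \<Lambda> \<Longrightarrow> \<sigma> i > 0"
  obtains xs where "distinct xs" "set xs = T"
    "sorted_wrt (\<lambda>i j. (\<sigma> j)\<^sup>2 \<le> (\<sigma> i)\<^sup>2) xs"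
    "\<And>j. j < length xs \<Longrightarrow>
      sigma2_ord \<Lambda> \<sigma> (restrict (indicator T) \<Lambda>) (Suc j) = (\<sigma> (xs ! j))\<^sup>2"
proof -
  let ?s = "\<lambda>i. (\<sigma> i)\<^sup>2"
  define h :: "'a \<Rightarrow> real" where "h = restrict (indicator T) \<Lambda>"
  let ?v = "\<lambda>i. h i * ?s i"
  have finT: "finite T"
    using fin T by (rule finite_subset[rotated])
  obtain ts where ts: "set ts = T" "distinct ts"
    using finite_distinct_list[OF finT] by blast
  obtain us where us: "set us = \<Lambda> - T" "distinct us"
    using finite_distinct_list[of "\<Lambda> - T"] fin by blast
  define xs where "xs = rev (sort_key ?s ts)"
  have xs: "set xs = T" "distinct xs"
    using ts by (auto simp: xs_def)
  have sx: "sorted_wrt (\<lambda>i j. ?s j \<le> ?s i) xs"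
    using sorted_sort_key[of ?s ts] by (simp add: xs_def sorted_wrt_rev sorted_wrt_map)
  have hx: "map ?v xs = map ?s xs"
    using xs T by (auto simp: h_def subset_iff)
  have hu: "map ?v us = map (\<lambda>_. 0) us"
    using us by (auto simp: h_def)
  have m: "mset (xs @ us) = mset_set \<Lambda>"
  proof -
    have "mset (xs @ us) = mset_set (set (xs @ us))"
      using xs us by (intro mset_set_set[symmetric]) auto
    then show ?thesis
      using xs us T by (simp add: Un_absorb1)
  qed
  have "sorted_wrt (\<ge>) (map ?v (xs @ us))"
    unfolding map_append hx hu sorted_wrt_append
    using sx by (auto simp: sorted_wrt_map sorted_wrt_iff_nth_less)
  then have "sorted (rev (map ?v (xs @ us)))"
    by (simp only: sorted_wrt_rev)
  then have "sort (map ?v (xs @ us)) = rev (map ?v (xs @ us))"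
    by (intro properties_for_sort) simp_all
  moreover have "image_mset ?v (mset_set \<Lambda>) = mset (map ?v (xs @ us))"
    unfolding m[symmetric] by simp
  ultimately have "rev (sorted_list_of_multiset (image_mset ?v (mset_set \<Lambda>))) = map ?v (xs @ us)"
    by (metis rev_rev_ident sorted_list_of_multiset_mset)
  then have "sigma2_ord \<Lambda> \<sigma> h (Suc j) = ?s (xs ! j)" if "j < length xs" for j
    using that arg_cong[OF hx, of "\<lambda>l. l ! j"] by (simp add: sigma2_ord_def nth_append)
  with that[OF xs(2,1) sx] show thesis
    by (simp add: h_def)
qed

lemma Pen_indicator_eq:
  assumes T: "T \<subseteq> \<Lambda>"
  shows "Pen \<Lambda> \<sigma> (restrict (indicator T) \<Lambda>) =
    (\<Sum>j<card T. sigma2_ord \<Lambda> \<sigma> (restrict (indicator T) \<Lambda>) (Suc j)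
        * threshold (card \<Lambda>) (log_plus (real (card \<Lambda>) * diag_norm \<sigma> \<Lambda>)) (Suc j))"
proof -
  have "support \<Lambda> (restrict (indicator T) \<Lambda>) = T"
    using T by (auto simp: support_def indicator_def)
  moreover have "{1..card T} = Suc ` {..<card T}"
    by (simp add: image_Suc_lessThan)
  ultimately show ?thesis
    by (simp add: Pen_def sum.reindex threshold_def sum_distrib_left algebra_simps)
qed

text \<open>The right side does not depend on the selected set \<open>T\<close>, which makes it usable for a data-dependent
selection. Heteroscedasticity costs only the factor \<open>diag_norm \<sigma> \<Lambda>\<close>: along an enumeration of \<open>T\<close> by
decreasing variance, every partial sum of standardized squares minus thresholds is at most the
overshoot, and Abel summation puts the variances back.\<close>

lemma noise_energy_minus_Pen_le:
  assumes fin: "finite \<Lambda>" and T: "T \<subseteq> \<Lambda>" and pos: "\<And>i. i \<in> \<Lambda> \<Longrightarrow> \<sigma> i > 0"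
  defines "c \<equiv> threshold (card \<Lambda>) (log_plus (real (card \<Lambda>) * diag_norm \<sigma> \<Lambda>))"
  shows "(\<Sum>i\<in>T. (\<xi> i)\<^sup>2) - Pen \<Lambda> \<sigma> (restrict (indicator T) \<Lambda>)
    \<le> diag_norm \<sigma> \<Lambda> * overshoot \<Lambda> c (\<lambda>i. (\<xi> i / \<sigma> i)\<^sup>2)"
proof -
  let ?w = "\<lambda>i. (\<xi> i / \<sigma> i)\<^sup>2"
  obtain xs where xs: "distinct xs" "set xs = T"
    "sorted_wrt (\<lambda>i j. (\<sigma> j)\<^sup>2 \<le> (\<sigma> i)\<^sup>2) xs"
    and ord: "\<And>j. j < length xs \<Longrightarrow>
      sigma2_ord \<Lambda> \<sigma> (restrict (indicator T) \<Lambda>) (Suc j) = (\<sigma> (xs ! j))\<^sup>2"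
    using sigma2_ord_enumeration[of \<Lambda> T \<sigma>] fin T pos by metis
  have k: "card T = length xs"
    using xs distinct_card by blast
  have mem: "xs ! j \<in> \<Lambda>" if "j < length xs" for j
    using that xs T by (auto simp: nth_mem)
  have "(\<Sum>i\<in>T. (\<xi> i)\<^sup>2) = (\<Sum>j<length xs. (\<xi> (xs ! j))\<^sup>2)"
    using sum_list_distinct_conv_sum_set[OF xs(1), of "\<lambda>i. (\<xi> i)\<^sup>2"] xs(2)
    by (simp add: sum_list_sum_nth atLeast0LessThan)
  also have "\<dots> = (\<Sum>j<length xs. (\<sigma> (xs ! j))\<^sup>2 * ?w (xs ! j))"
    using less_imp_neq[OF pos[OF mem], symmetric] by (intro sum.cong) (auto simp: power_divide)
  finally have "(\<Sum>i\<in>T. (\<xi> i)\<^sup>2) - Pen \<Lambda> \<sigma> (restrict (indicator T) \<Lambda>) =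
      (\<Sum>j<length xs. (\<sigma> (xs ! j))\<^sup>2 * (?w (xs ! j) - c (Suc j)))"
    by (simp add: Pen_indicator_eq[OF T] k ord c_def sum_subtractf algebra_simps)
  also have "\<dots> \<le> diag_norm \<sigma> \<Lambda> * overshoot \<Lambda> c ?w"
  proof (rule weighted_sum_le_of_partial_sums)
    fix m assume m: "m \<le> length xs"
    define A where "A = set (take m xs)"
    have A: "finite A" "A \<subseteq> \<Lambda>"
      using xs T by (auto simp: A_def dest: in_set_takeD)
    have dt: "distinct (take m xs)"
      using xs by simp
    have cA: "card A = m"
      using m distinct_card[OF dt] by (simp add: A_def)
    have "(\<Sum>i\<in>A. ?w i) = sum_list (map ?w (take m xs))"
      unfolding A_def using dt by (rule sum_list_distinct_conv_sum_set[symmetric])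
    also have "\<dots> = (\<Sum>j<m. ?w (xs ! j))"
      using m by (simp add: sum_list_sum_nth atLeast0LessThan)
    finally have 1: "(\<Sum>i\<in>A. ?w i) = (\<Sum>j<m. ?w (xs ! j))" .
    have 2: "(\<Sum>j = 1..card A. c j) = (\<Sum>j<m. c (Suc j))"
    proof -
      have "{1..card A} = Suc ` {..<m}"
        by (simp add: image_Suc_lessThan cA)
      then show ?thesis
        by (simp add: sum.reindex)
    qed
    have "(\<Sum>j<m. ?w (xs ! j) - c (Suc j)) \<le> overshoot A c ?w"
      using sum_minus_thresholds_le_overshoot[OF A(1), of ?w c]
      unfolding 1 2 by (simp add: sum_subtractf)
    also have "\<dots> \<le> overshoot \<Lambda> c ?w"
      using fin A(2) by (rule overshoot_mono)
    finally show "(\<Sum>j<m. ?w (xs ! j) - c (Suc j)) \<le> overshoot \<Lambda> c ?w" .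
  qed (use xs(3) mem diag_norm_ge[OF fin] diag_norm_nonneg[OF fin] in
      \<open>auto simp: sorted_wrt_iff_nth_less\<close>)
  finally show ?thesis .
qed

section \<open>Gaussian expectation of the overshoot\<close>

text \<open>On \<open>z \<ge> sqrt c\<close> the factor \<open>z / sqrt c\<close> is at least \<open>1\<close>, and the integrand multiplied by it has an
elementary antiderivative, as in the proof of the bound for Mills' ratio; the two tails contribute
\<open>2 / sqrt (2 * pi * c) * exp (- c / 2)\<close>. For \<open>c \<ge> 2\<close> the constant is at most \<open>1 / sqrt pi < 1 / sqrt 3 < 11 / 19\<close>. A constant below \<open>1\<close> is what makes
the union bound over all subsets summable.\<close>

lemma nn_integral_excess_std_normal_le:
  assumes k: "1 \<le> k" and c: "2 \<le> c"
  shows "(\<integral>\<^sup>+z. ennreal (std_normal_density z * excess k c (z\<^sup>2)) \<partial>lborel)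
    \<le> ennreal (11 / 19 * exp (- c / 2))"
proof -
  define t where "t = sqrt c"
  have t: "0 < t" "t\<^sup>2 = c"
    using c by (auto simp: t_def)
  \<comment> \<open>\<open>H\<close> is the even integrand, \<open>f\<close> its majorant on the right tail and \<open>F\<close> the antiderivative of \<open>f\<close>.\<close>
  define H where "H z = std_normal_density z * excess k c (z\<^sup>2)" for z
  have H0: "0 \<le> H z" for z
    using excess_nonneg[OF k] by (simp add: H_def)
  have H_meas [measurable]: "H \<in> borel_measurable borel"
    unfolding H_def excess_def by measurable
  define f where "f z = z / t * std_normal_density z * (1 + ((z\<^sup>2 - c) / 2 - 1) / k)" for z
  define F where "F z = - (1 / t) * std_normal_density z * (1 + (z\<^sup>2 - c) / (2 * k))" for z
  have le: "c \<le> z\<^sup>2" if "t \<le> z" for z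
    using that t power_mono[of t z 2] by simp
  have fH: "f z = z / t * H z" if "c \<le> z\<^sup>2" for z
    using that by (simp add: f_def H_def excess_def)
  have "(\<integral>\<^sup>+z. ennreal (f z) * indicator {t..} z \<partial>lborel) = ennreal (0 - F t)"
  proof (rule nn_integral_FTC_atLeast)
    show "f \<in> borel_measurable borel"
      unfolding f_def by measurable
    have phi: "DERIV std_normal_density z :> - (z * std_normal_density z)" for z
      unfolding std_normal_density_def by (auto intro!: derivative_eq_intros simp: field_simps)
    have inner: "DERIV (\<lambda>z. 1 + (z\<^sup>2 - c) / (2 * k)) z :> z / k" for z
      using k by (auto intro!: derivative_eq_intros)
    show "DERIV F z :> f z" for z
      unfolding F_def
      by (rule DERIV_cong[OF DERIV_mult[OF DERIV_cmult[OF phi] inner]])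
        (use k t(1) in \<open>simp add: f_def field_simps\<close>)
    show "0 \<le> f z" if "t \<le> z" for z
      using that t(1) H0[of z] by (simp add: fH[OF le[OF that]])
    show "(F \<longlongrightarrow> 0) at_top"
      unfolding F_def std_normal_density_def using k t(1) by real_asymp
  qed
  also have "0 - F t = std_normal_density t / t"
    by (simp add: F_def t)
  finally have f_int: "(\<integral>\<^sup>+z. ennreal (f z) * indicator {t..} z \<partial>lborel)
      = ennreal (std_normal_density t / t)" .
  have half: "(\<integral>\<^sup>+z. ennreal (H z) * indicator {0..} z \<partial>lborel) \<le> ennreal (std_normal_density t / t)"
    unfolding f_int[symmetric]
  proof (rule nn_integral_mono)
    fix z :: real
    show "ennreal (H z) * indicator {0..} z \<le> ennreal (f z) * indicator {t..} z"
    proof (cases "0 \<le> z \<and> c \<le> z\<^sup>2")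
      case True
      then have tz: "t \<le> z"
        by (simp add: t_def real_le_lsqrt)
      then have "1 * H z \<le> z / t * H z"
        using H0[of z] t(1) by (intro mult_right_mono) auto
      then have "H z \<le> f z"
        using True fH[of z] by simp
      then show ?thesis
        using tz True by (simp add: ennreal_leI)
    next
      case False
      then have zero: "ennreal (H z) * indicator {0..} z = 0"
        by (auto simp: H_def excess_def indicator_def)
      show ?thesis
        unfolding zero by simp
    qed
  qed
  have even: "H (- z) = H z" for z
    by (simp add: H_def std_normal_density_def)
  have [measurable]: "(\<lambda>z. ennreal (H z) * indicator {0..} (- z)) \<in> borel_measurable borel"
    by measurable
  have refl: "(\<integral>\<^sup>+z. ennreal (H z) * indicator {0..} (- z) \<partial>lborel)
      = (\<integral>\<^sup>+z. ennreal (H z) * indicator {0..} z \<partial>lborel)"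
    by (subst nn_integral_real_affine[where c = "-1" and t = 0])
      (simp_all add: even)
  have "(\<integral>\<^sup>+z. ennreal (H z) \<partial>lborel)
      \<le> (\<integral>\<^sup>+z. ennreal (H z) * indicator {0..} z + ennreal (H z) * indicator {0..} (- z) \<partial>lborel)"
    by (intro nn_integral_mono) (auto simp: indicator_def)
  also have "\<dots> = (\<integral>\<^sup>+z. ennreal (H z) * indicator {0..} z \<partial>lborel)
      + (\<integral>\<^sup>+z. ennreal (H z) * indicator {0..} (- z) \<partial>lborel)"
    by (rule nn_integral_add) measurable
  also have "\<dots> \<le> ennreal (std_normal_density t / t) + ennreal (std_normal_density t / t)"
    unfolding refl using half by (intro add_mono)
  also have "\<dots> = ennreal (2 / (sqrt (2 * pi) * t) * exp (- c / 2))"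
    using t by (subst ennreal_plus[symmetric]) (auto simp: std_normal_density_def field_simps)
  also have "\<dots> \<le> ennreal (11 / 19 * exp (- c / 2))"
  proof (intro ennreal_leI mult_right_mono)
    \<comment> \<open>\<open>(38 / 11)\<^sup>2 < 12 < 2 * pi * c\<close>, so \<open>pi > 3\<close> is precise enough.\<close>
    have "38 / 11 = sqrt ((38 / 11)\<^sup>2)"
      by simp
    also have "\<dots> \<le> sqrt ((2 * pi) * c)"
    proof (intro real_sqrt_le_mono)
      have "(38 / 11)\<^sup>2 \<le> (2 * 3 :: real) * 2"
        by (simp add: power2_eq_square)
      also have "\<dots> \<le> (2 * pi) * c"
        using c pi_gt3 by (intro mult_mono) auto
      finally show "(38 / 11)\<^sup>2 \<le> (2 * pi) * c" .
    qed
    also have "\<dots> = sqrt (2 * pi) * t"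
      by (simp add: t_def real_sqrt_mult)
    finally have "38 / 11 \<le> sqrt (2 * pi) * t" .
    then have "2 / (sqrt (2 * pi) * t) \<le> 2 / (38 / 11)"
      by (intro divide_left_mono) auto
    then show "2 / (sqrt (2 * pi) * t) \<le> 11 / 19"
      by simp
  qed simp
  finally show ?thesis
    by (simp add: H_def)
qed

lemma nn_integral_excess_normal_le:
  assumes s: "0 < s" and k: "1 \<le> k" and c: "2 \<le> c"
  shows "(\<integral>\<^sup>+z. ennreal (excess k c ((z / s)\<^sup>2)) \<partial>density lborel (\<lambda>x. ennreal (normal_density 0 s x)))
    \<le> ennreal (11 / 19 * exp (- c / 2))"
proof -
  have [measurable]: "(\<lambda>z. excess k c ((z / s)\<^sup>2)) \<in> borel_measurable borel"
    unfolding excess_def by measurable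
  have scale: "s * normal_density 0 s (s * z) = std_normal_density z" for z
    using s by (simp add: normal_density_def power_mult_distrib real_sqrt_mult)
  have "(\<integral>\<^sup>+z. ennreal (excess k c ((z / s)\<^sup>2)) \<partial>density lborel (\<lambda>x. ennreal (normal_density 0 s x)))
      = (\<integral>\<^sup>+z. ennreal (normal_density 0 s z * excess k c ((z / s)\<^sup>2)) \<partial>lborel)"
    by (subst nn_integral_density) (auto simp: ennreal_mult' intro!: nn_integral_cong)
  also have "\<dots> = ennreal s * (\<integral>\<^sup>+z. ennreal (normal_density 0 s (s * z) * excess k c (z\<^sup>2)) \<partial>lborel)"
    using s by (subst nn_integral_real_affine[where c = s and t = 0]) auto
  also have "\<dots> = (\<integral>\<^sup>+z. ennreal s * ennreal (normal_density 0 s (s * z) * excess k c (z\<^sup>2)) \<partial>lborel)"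
    unfolding excess_def by (rule nn_integral_cmult[symmetric]) measurable
  also have "\<dots> = (\<integral>\<^sup>+z. ennreal (std_normal_density z * excess k c (z\<^sup>2)) \<partial>lborel)"
    using s excess_nonneg[OF k]
    by (intro nn_integral_cong) (auto simp: ennreal_mult'[symmetric] mult.assoc[symmetric] scale)
  also have "\<dots> \<le> ennreal (11 / 19 * exp (- c / 2))"
    using k c by (rule nn_integral_excess_std_normal_le)
  finally show ?thesis .
qed

lemma nn_integral_square_normal:
  assumes s: "0 < s"
  shows "(\<integral>\<^sup>+z. ennreal (z\<^sup>2) \<partial>density lborel (\<lambda>x. ennreal (normal_density 0 s x))) = ennreal (s\<^sup>2)"
proof -
  have "(\<integral>\<^sup>+z. ennreal (z\<^sup>2) \<partial>density lborel (\<lambda>x. ennreal (normal_density 0 s x)))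
      = (\<integral>\<^sup>+z. ennreal (normal_density 0 s z * z\<^sup>2) \<partial>lborel)"
    by (subst nn_integral_density) (auto simp: ennreal_mult' intro!: nn_integral_cong)
  also have "\<dots> = ennreal (\<integral>z. normal_density 0 s z * z\<^sup>2 \<partial>lborel)"
    using integrable_normal_moment[OF s, of 0 2] by (intro nn_integral_eq_integral) auto
  also have "(\<integral>z. normal_density 0 s z * z\<^sup>2 \<partial>lborel) = s\<^sup>2"
    using integral_normal_moment_even[OF s, of 0 1] by (simp add: fact_numeral)
  finally show ?thesis .
qed

lemma measurable_noise_component:
  assumes "i \<in> \<Lambda>"
  shows "(\<lambda>\<xi>. \<xi> i) \<in> borel_measurable (noise \<Lambda> \<sigma>)"
  using measurable_component_singleton[OF assms,
      of "\<lambda>i. density lborel (\<lambda>x. ennreal (normal_density 0 (\<sigma> i) x))"]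
  by (simp add: noise_def)

lemma nn_integral_noise_prod:
  assumes fin: "finite \<Lambda>" and A: "A \<subseteq> \<Lambda>" and pos: "\<And>i. i \<in> \<Lambda> \<Longrightarrow> \<sigma> i > 0"
    and F [measurable]: "\<And>i. F i \<in> borel_measurable borel"
  shows "(\<integral>\<^sup>+\<xi>. (\<Prod>i\<in>A. F i (\<xi> i)) \<partial>noise \<Lambda> \<sigma>)
    = (\<Prod>i\<in>A. \<integral>\<^sup>+z. F i z \<partial>density lborel (\<lambda>x. ennreal (normal_density 0 (\<sigma> i) x)))"
proof -
  \<comment> \<open>Off \<open>\<Lambda>\<close> a fixed standard normal law replaces the given one: the scale may fail to be positive there.\<close>
  define N where "N i = density lborel (\<lambda>x. ennreal (normal_density 0 (if i \<in> \<Lambda> then \<sigma> i else 1) x))" for i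
  have prob: "prob_space (N i)" for i
    unfolding N_def by (rule prob_space_normal_density) (auto simp: pos)
  interpret product_sigma_finite N
    by standard (meson prob prob_space_imp_sigma_finite sigma_finite_measure.sigma_finite_countable)
  have noise: "noise \<Lambda> \<sigma> = PiM \<Lambda> N"
    unfolding noise_def by (rule PiM_cong) (auto simp: N_def)
  define G where "G i = (if i \<in> A then F i else (\<lambda>_. 1))" for i
  have G: "G i \<in> borel_measurable (N i)" for i
    by (auto simp: G_def N_def)
  have "(\<Prod>i\<in>A. F i (\<xi> i)) = (\<Prod>i\<in>\<Lambda>. G i (\<xi> i))" for \<xi>
    using A fin by (intro prod.mono_neutral_cong_left) (auto simp: G_def)
  then have "(\<integral>\<^sup>+\<xi>. (\<Prod>i\<in>A. F i (\<xi> i)) \<partial>noise \<Lambda> \<sigma>) = (\<Prod>i\<in>\<Lambda>. integral\<^sup>N (N i) (G i))"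
    using fin G by (simp add: noise product_nn_integral_prod)
  also have "\<dots> = (\<Prod>i\<in>A. integral\<^sup>N (N i) (F i))"
    using A fin prob by (intro prod.mono_neutral_cong_right)
      (auto simp: G_def prob_space.emeasure_space_1)
  also have "\<dots> = (\<Prod>i\<in>A. \<integral>\<^sup>+z. F i z \<partial>density lborel (\<lambda>x. ennreal (normal_density 0 (\<sigma> i) x)))"
    using A by (intro prod.cong) (auto simp: N_def)
  finally show ?thesis .
qed

lemma power_over_fact_le_exp:
  fixes x :: real
  assumes "0 \<le> x"
  shows "x ^ n / fact n \<le> exp x"
proof -
  have "(\<Sum>j\<in>{n}. x ^ j /\<^sub>R fact j) \<le> (\<Sum>j. x ^ j /\<^sub>R fact j)"
    using assms by (intro sum_le_suminf summable_exp_generic) auto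
  then show ?thesis
    by (simp add: exp_def field_simps)
qed

lemma binomial_le_power_exp:
  assumes "1 \<le> j"
  shows "real (n choose j) \<le> (real n * exp 1 / real j) ^ j"
proof -
  have "real (n choose j) * fact j \<le> real n ^ j"
    using binomial_fact_pow[of n j] by (metis of_nat_fact of_nat_le_iff of_nat_mult of_nat_power)
  then have "real (n choose j) \<le> real n ^ j / fact j"
    by (simp add: field_simps)
  also have "\<dots> = (real n / real j) ^ j * (real j ^ j / fact j)"
    using assms by (simp add: power_divide)
  also have "\<dots> \<le> (real n / real j) ^ j * exp (real j)"
    by (intro mult_left_mono power_over_fact_le_exp) auto
  also have "\<dots> = (real n * exp 1 / real j) ^ j"
    by (simp add: power_divide power_mult_distrib flip: exp_of_nat_mult)
  finally show ?thesis .
qed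

lemma threshold_ge_2:
  assumes "1 \<le> j" "j \<le> n" "0 \<le> L"
  shows "2 \<le> threshold n L j"
proof -
  have "ln (exp 1) \<le> ln (real n * exp 1 / real j)"
    using assms by (intro ln_mono) (auto simp: field_simps)
  moreover have "0 \<le> 1 / real j * L"
    using assms by simp
  ultimately show ?thesis
    by (simp add: threshold_def)
qed

text \<open>This is the reason for the form of the penalty: the part \<open>ln (n * e / j)\<close> of the threshold, taken \<open>j\<close>
times, cancels the number of subsets of size \<open>j\<close>, and the part \<open>L / j\<close> leaves the factor \<open>exp (- L)\<close>.\<close>

lemma binomial_threshold_le:
  assumes j: "1 \<le> j" "j \<le> n"
  shows "real (n choose j) * (q * exp (- threshold n L j / 2)) ^ j \<le> exp (- L) * \<bar>q\<bar> ^ j"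
proof -
  define y where "y = real n * exp 1 / real j"
  have y: "0 < y"
    using j by (simp add: y_def)
  have "real j * (- threshold n L j / 2) = - (real j * ln y) - L"
    using j by (simp add: threshold_def y_def field_simps)
  then have "exp (- threshold n L j / 2) ^ j = exp (- (real j * ln y) - L)"
    by (simp only: exp_of_nat_mult[symmetric])
  also have "\<dots> = exp (- L) / y ^ j"
    using y by (simp add: exp_diff exp_minus field_simps exp_of_nat_mult)
  finally have e: "exp (- threshold n L j / 2) ^ j = exp (- L) / y ^ j" .
  have "real (n choose j) * (q * exp (- threshold n L j / 2)) ^ j
      \<le> real (n choose j) * (\<bar>q\<bar> ^ j * (exp (- L) / y ^ j))"
    unfolding power_mult_distrib e using y
    by (intro mult_left_mono mult_right_mono) (auto simp: power_abs[symmetric])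
  also have "\<dots> \<le> y ^ j * (\<bar>q\<bar> ^ j * (exp (- L) / y ^ j))"
    using binomial_le_power_exp[OF j(1), of n] y by (intro mult_right_mono) (auto simp: y_def)
  finally show ?thesis
    using y by (simp add: mult_ac)
qed

lemma sum_nonempty_subsets_by_card:
  fixes g :: "nat \<Rightarrow> real"
  assumes "finite \<Lambda>"
  shows "(\<Sum>A \<in> Pow \<Lambda> - {{}}. g (card A)) = (\<Sum>j = 1..card \<Lambda>. real (card \<Lambda> choose j) * g j)"
proof -
  have "(\<Sum>A \<in> Pow \<Lambda> - {{}}. g (card A))
      = (\<Sum>j = 1..card \<Lambda>. \<Sum>A | A \<in> Pow \<Lambda> - {{}} \<and> card A = j. g (card A))"
  proof (rule sum.group[symmetric])
    show "card ` (Pow \<Lambda> - {{}}) \<subseteq> {1..card \<Lambda>}"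
      using assms by (auto simp: card_mono card_gt_0_iff Suc_le_eq dest: finite_subset)
  qed (use assms in auto)
  also have "\<dots> = (\<Sum>j = 1..card \<Lambda>. \<Sum>A | A \<subseteq> \<Lambda> \<and> card A = j. g j)"
    by (intro sum.cong) auto
  finally show ?thesis
    using n_subsets[OF assms] by simp
qed

text \<open>By independence each product of excesses integrates to a product, and after grouping the subsets
by size the bound is the geometric series \<open>2 * exp (- L) * (q + q\<^sup>2 + \<dots>)\<close> with \<open>q = 11 / 19\<close>,
for which \<open>q / (1 - q) = 11 / 8\<close>.\<close>

lemma nn_integral_overshoot_le:
  assumes fin: "finite \<Lambda>" and pos: "\<And>i. i \<in> \<Lambda> \<Longrightarrow> \<sigma> i > 0" and L: "0 \<le> L"
  shows "(\<integral>\<^sup>+\<xi>. ennreal (overshoot \<Lambda> (threshold (card \<Lambda>) L) (\<lambda>i. (\<xi> i / \<sigma> i)\<^sup>2)) \<partial>noise \<Lambda> \<sigma>)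
    \<le> ennreal (11 / 4 * exp (- L))"
proof -
  let ?c = "threshold (card \<Lambda>) L"
  let ?q = "11 / 19 :: real"
  let ?e = "\<lambda>A i z. excess (card A) (?c (card A)) ((z / \<sigma> i)\<^sup>2)"
  have card: "1 \<le> card A" "card A \<le> card \<Lambda>" "A \<subseteq> \<Lambda>" if "A \<in> Pow \<Lambda> - {{}}" for A
    using that fin by (auto simp: card_mono card_gt_0_iff Suc_le_eq dest: finite_subset)
  have e_meas [measurable]: "(\<lambda>z. ennreal (?e A i z)) \<in> borel_measurable borel" for A i
    unfolding excess_def by measurable
  have split: "ennreal (overshoot \<Lambda> ?c (\<lambda>i. (\<xi> i / \<sigma> i)\<^sup>2))
      = (\<Sum>A \<in> Pow \<Lambda> - {{}}. ennreal 2 * (\<Prod>i\<in>A. ennreal (?e A i (\<xi> i))))" for \<xi>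
  proof -
    have "ennreal (overshoot \<Lambda> ?c (\<lambda>i. (\<xi> i / \<sigma> i)\<^sup>2))
        = (\<Sum>A \<in> Pow \<Lambda> - {{}}. ennreal (2 * (\<Prod>i\<in>A. ?e A i (\<xi> i))))"
      unfolding overshoot_def
      by (intro sum_ennreal[symmetric] mult_nonneg_nonneg excess_prod_nonneg[OF fin]) auto
    also have "\<dots> = (\<Sum>A \<in> Pow \<Lambda> - {{}}. ennreal 2 * (\<Prod>i\<in>A. ennreal (?e A i (\<xi> i))))"
    proof (intro sum.cong refl)
      fix A assume "A \<in> Pow \<Lambda> - {{}}"
      then have "0 \<le> ?e A i z" for i z
        using card by (intro excess_nonneg)
      then show "ennreal (2 * (\<Prod>i\<in>A. ?e A i (\<xi> i))) = ennreal 2 * (\<Prod>i\<in>A. ennreal (?e A i (\<xi> i)))"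
        by (simp add: ennreal_mult' prod_ennreal)
    qed
    finally show ?thesis .
  qed
  have term_le: "(\<integral>\<^sup>+\<xi>. ennreal 2 * (\<Prod>i\<in>A. ennreal (?e A i (\<xi> i))) \<partial>noise \<Lambda> \<sigma>)
      \<le> ennreal (2 * (?q * exp (- ?c (card A) / 2)) ^ card A)" if A: "A \<in> Pow \<Lambda> - {{}}" for A
  proof -
    have "(\<integral>\<^sup>+\<xi>. ennreal 2 * (\<Prod>i\<in>A. ennreal (?e A i (\<xi> i))) \<partial>noise \<Lambda> \<sigma>)
        = ennreal 2 * (\<integral>\<^sup>+\<xi>. (\<Prod>i\<in>A. ennreal (?e A i (\<xi> i))) \<partial>noise \<Lambda> \<sigma>)"
      using card(3)[OF A]
      by (intro nn_integral_cmult borel_measurable_prod_ennreal measurable_compose[OF measurable_noise_component e_meas]) auto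
    also have "(\<integral>\<^sup>+\<xi>. (\<Prod>i\<in>A. ennreal (?e A i (\<xi> i))) \<partial>noise \<Lambda> \<sigma>)
        = (\<Prod>i\<in>A. \<integral>\<^sup>+z. ennreal (?e A i z) \<partial>density lborel (\<lambda>x. ennreal (normal_density 0 (\<sigma> i) x)))"
      by (rule nn_integral_noise_prod[OF fin card(3)[OF A] pos e_meas])
    also have "\<dots> \<le> (\<Prod>i\<in>A. ennreal (?q * exp (- ?c (card A) / 2)))"
      using card[OF A] pos threshold_ge_2[OF _ _ L]
      by (intro prod_mono_ennreal nn_integral_excess_normal_le) auto
    also have "\<dots> = ennreal ((?q * exp (- ?c (card A) / 2)) ^ card A)"
      by (simp add: ennreal_power)
    finally show ?thesis
      by (simp add: ennreal_mult' mult_left_mono)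
  qed
  have "(\<integral>\<^sup>+\<xi>. ennreal (overshoot \<Lambda> ?c (\<lambda>i. (\<xi> i / \<sigma> i)\<^sup>2)) \<partial>noise \<Lambda> \<sigma>)
      = (\<Sum>A \<in> Pow \<Lambda> - {{}}. \<integral>\<^sup>+\<xi>. ennreal 2 * (\<Prod>i\<in>A. ennreal (?e A i (\<xi> i))) \<partial>noise \<Lambda> \<sigma>)"
    unfolding split
    by (intro nn_integral_sum borel_measurable_times_ennreal borel_measurable_const
        borel_measurable_prod_ennreal measurable_compose[OF measurable_noise_component e_meas]) auto
  also have "\<dots> \<le> (\<Sum>A \<in> Pow \<Lambda> - {{}}. ennreal (2 * (?q * exp (- ?c (card A) / 2)) ^ card A))"
    using term_le by (rule sum_mono)
  also have "\<dots> = ennreal (\<Sum>A \<in> Pow \<Lambda> - {{}}. 2 * (?q * exp (- ?c (card A) / 2)) ^ card A)"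
    by (intro sum_ennreal) auto
  also have "\<dots> \<le> ennreal (11 / 4 * exp (- L))"
  proof (rule ennreal_leI)
    have "(\<Sum>A \<in> Pow \<Lambda> - {{}}. 2 * (?q * exp (- ?c (card A) / 2)) ^ card A)
        = (\<Sum>j = 1..card \<Lambda>. real (card \<Lambda> choose j) * (2 * (?q * exp (- ?c j / 2)) ^ j))"
      by (rule sum_nonempty_subsets_by_card[OF fin])
    also have "\<dots> \<le> (\<Sum>j = 1..card \<Lambda>. 2 * (exp (- L) * ?q ^ j))"
      using binomial_threshold_le[of _ "card \<Lambda>" ?q L] by (intro sum_mono) auto
    also have "\<dots> = 2 * exp (- L) * (\<Sum>j = 1..card \<Lambda>. ?q ^ j)"
      by (simp add: sum_distrib_left mult.assoc)
    also have "\<dots> \<le> 2 * exp (- L) * (11 / 8)"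
    proof (intro mult_left_mono)
      have "(\<Sum>j = 1..m. ?q ^ j) = 11 / 8 * (1 - ?q ^ m)" for m
        by (induction m) (simp_all add: algebra_simps)
      then show "(\<Sum>j = 1..card \<Lambda>. ?q ^ j) \<le> 11 / 8"
        by simp
    qed simp
    finally show "(\<Sum>A \<in> Pow \<Lambda> - {{}}. 2 * (?q * exp (- ?c (card A) / 2)) ^ card A) \<le> 11 / 4 * exp (- L)"
      by simp
  qed
  finally show ?thesis .
qed

section \<open>Oracle inequality\<close>

lemma integrable_orthonormal_product:
  assumes "orthonormal_system \<mu> \<Lambda> \<psi>" "i \<in> \<Lambda>" "j \<in> \<Lambda>"
  shows "integrable \<mu> (\<lambda>t. \<psi> i t * \<psi> j t)"
proof (rule Bochner_Integration.integrable_bound)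
  show "integrable \<mu> (\<lambda>t. (\<psi> i t)\<^sup>2 + (\<psi> j t)\<^sup>2)"
    using assms by (auto simp: orthonormal_system_def)
  show "(\<lambda>t. \<psi> i t * \<psi> j t) \<in> borel_measurable \<mu>"
    using assms by (intro borel_measurable_times) (auto simp: orthonormal_system_def)
  have "\<bar>x * y\<bar> \<le> x\<^sup>2 + y\<^sup>2" for x y :: real
  proof -
    have "2 * (\<bar>x\<bar> * \<bar>y\<bar>) \<le> x\<^sup>2 + y\<^sup>2"
      using sum_squares_bound[of "\<bar>x\<bar>" "\<bar>y\<bar>"] by simp
    moreover have "0 \<le> \<bar>x\<bar> * \<bar>y\<bar>"
      by simp
    ultimately show ?thesis
      unfolding abs_mult by linarith
  qed
  then show "AE t in \<mu>. norm (\<psi> i t * \<psi> j t) \<le> norm ((\<psi> i t)\<^sup>2 + (\<psi> j t)\<^sup>2)"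
    by simp
qed

lemma L2_norm_series_power2:
  assumes fin: "finite \<Lambda>" and on: "orthonormal_system \<mu> \<Lambda> \<psi>"
  shows "(L2_norm \<mu> (series \<Lambda> \<psi> a))\<^sup>2 = (\<Sum>i\<in>\<Lambda>. (a i)\<^sup>2)"
proof -
  have "(series \<Lambda> \<psi> a t)\<^sup>2 = (\<Sum>i\<in>\<Lambda>. \<Sum>j\<in>\<Lambda>. a i * a j * (\<psi> i t * \<psi> j t))" for t
    by (simp add: series_def power2_eq_square sum_product mult_ac)
  then have "(\<integral>t. (series \<Lambda> \<psi> a t)\<^sup>2 \<partial>\<mu>)
      = (\<integral>t. (\<Sum>i\<in>\<Lambda>. \<Sum>j\<in>\<Lambda>. a i * a j * (\<psi> i t * \<psi> j t)) \<partial>\<mu>)"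
    by simp
  also have "\<dots> = (\<Sum>i\<in>\<Lambda>. \<Sum>j\<in>\<Lambda>. a i * a j * (\<integral>t. \<psi> i t * \<psi> j t \<partial>\<mu>))"
    using integrable_orthonormal_product[OF on] by simp
  also have "\<dots> = (\<Sum>i\<in>\<Lambda>. \<Sum>j\<in>\<Lambda>. if i = j then (a i)\<^sup>2 else 0)"
    using on by (intro sum.cong) (auto simp: orthonormal_system_def power2_eq_square)
  also have "\<dots> = (\<Sum>i\<in>\<Lambda>. (a i)\<^sup>2)"
    using fin by simp
  finally show ?thesis
    by (simp add: L2_norm_def sum_nonneg)
qed

lemma L2_norm_f_hat_minus_series_power2:
  assumes "finite \<Lambda>" "orthonormal_system \<mu> \<Lambda> \<psi>"
  shows "(L2_norm \<mu> (\<lambda>t. f_hat \<Lambda> \<psi> x h t - series \<Lambda> \<psi> a t))\<^sup>2 = (\<Sum>i\<in>\<Lambda>. (h i * x i - a i)\<^sup>2)"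
proof -
  have "(\<lambda>t. f_hat \<Lambda> \<psi> x h t - series \<Lambda> \<psi> a t) = series \<Lambda> \<psi> (\<lambda>i. h i * x i - a i)"
    by (simp add: f_hat_def series_def sum_subtractf left_diff_distrib)
  then show ?thesis
    using L2_norm_series_power2[OF assms] by simp
qed

lemma criterion_eq:
  assumes "finite \<Lambda>" "orthonormal_system \<mu> \<Lambda> \<psi>"
  shows "criterion \<mu> \<Lambda> \<psi> \<sigma> x h = (\<Sum>i\<in>\<Lambda>. (h i * x i - x i)\<^sup>2) + 2 * Pen \<Lambda> \<sigma> h"
  using L2_norm_f_hat_minus_series_power2[OF assms] by (simp add: criterion_def)

lemma penalized_selectorE:
  assumes "penalized_selector \<mu> \<Lambda> \<psi> \<sigma> h" "x \<in> \<Lambda> \<rightarrow>\<^sub>E UNIV"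
  obtains T where "T \<subseteq> \<Lambda>" "h x = restrict (indicator T) \<Lambda>"
    "\<And>S. S \<subseteq> \<Lambda> \<Longrightarrow> criterion \<mu> \<Lambda> \<psi> \<sigma> x (h x) \<le> criterion \<mu> \<Lambda> \<psi> \<sigma> x (restrict (indicator S) \<Lambda>)"
proof -
  obtain g where g: "is_arg_min (\<lambda>g. criterion \<mu> \<Lambda> \<psi> \<sigma> x (g x)) (\<lambda>g. g \<in> subset_selections \<Lambda>) g"
    and hx: "h x = g x"
    using assms by (auto simp: penalized_selector_def)
  then obtain T where T: "T \<subseteq> \<Lambda>" "g = (\<lambda>_. restrict (indicator T) \<Lambda>)"
    by (auto simp: is_arg_min_linorder subset_selections_def)
  show thesis
  proof (rule that[OF T(1)])
    show "h x = restrict (indicator T) \<Lambda>"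
      by (simp add: hx T)
    fix S assume "S \<subseteq> \<Lambda>"
    then have "(\<lambda>_. restrict (indicator S) \<Lambda>) \<in> subset_selections \<Lambda>"
      by (auto simp: subset_selections_def)
    then show "criterion \<mu> \<Lambda> \<psi> \<sigma> x (h x) \<le> criterion \<mu> \<Lambda> \<psi> \<sigma> x (restrict (indicator S) \<Lambda>)"
      using g hx by (auto simp: is_arg_min_linorder)
  qed
qed

text \<open>The comparison of the selected set \<open>T\<close> with the support \<open>S\<close> of \<open>f\<close> in the criterion. The loss has the
noise on \<open>T\<close> and the signal off \<open>T\<close>; the criterion controls the latter by \<open>2 * Pen S - 2 * Pen T\<close> up to
the noise on \<open>T\<close> a second time, which produces twice the difference of noise energy and penalty. The
only mixed terms are \<open>f i * \<xi> i\<close> with \<open>i \<in> S - T\<close>; giving away the fraction \<open>\<delta>\<close> of the loss removes them at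
the price of \<open>(\<xi> i)\<^sup>2 / \<delta>\<close> on \<open>S\<close>.\<close>

lemma selected_loss_le:
  fixes f \<xi> :: "'i \<Rightarrow> real"
  assumes fin: "finite \<Lambda>" and pos: "\<And>i. i \<in> \<Lambda> \<Longrightarrow> \<sigma> i > 0"
    and on: "orthonormal_system \<mu> \<Lambda> \<psi>"
    and sel: "penalized_selector \<mu> \<Lambda> \<psi> \<sigma> h"
    and \<delta>: "0 < \<delta>" "\<delta> < 1"
  defines "S \<equiv> {i \<in> \<Lambda>. f i \<noteq> 0}"
    and "c \<equiv> threshold (card \<Lambda>) (log_plus (real (card \<Lambda>) * diag_norm \<sigma> \<Lambda>))"
    and "x \<equiv> observation \<Lambda> f \<xi>"
  shows "(1 - \<delta>) * (L2_norm \<mu> (\<lambda>t. f_hat \<Lambda> \<psi> x (h x) t - series \<Lambda> \<psi> f t))\<^sup>2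
    \<le> 2 * Pen \<Lambda> \<sigma> (restrict (indicator S) \<Lambda>) + (\<Sum>i\<in>S. (\<xi> i)\<^sup>2) / \<delta>
      + 2 * (diag_norm \<sigma> \<Lambda> * overshoot \<Lambda> c (\<lambda>i. (\<xi> i / \<sigma> i)\<^sup>2))"
proof -
  have x: "x i = f i + \<xi> i" if "i \<in> \<Lambda>" for i
    using that by (auto simp: x_def observation_def)
  have xE: "x \<in> \<Lambda> \<rightarrow>\<^sub>E UNIV"
    by (auto simp: x_def observation_def)
  obtain T where T: "T \<subseteq> \<Lambda>" and hx: "h x = restrict (indicator T) \<Lambda>"
    and min: "\<And>S. S \<subseteq> \<Lambda> \<Longrightarrow>
      criterion \<mu> \<Lambda> \<psi> \<sigma> x (h x) \<le> criterion \<mu> \<Lambda> \<psi> \<sigma> x (restrict (indicator S) \<Lambda>)"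
    using penalized_selectorE[OF sel xE] by metis
  let ?r = "\<lambda>A i. (restrict (indicator A) \<Lambda> i * x i - x i)\<^sup>2"
  have S: "S \<subseteq> \<Lambda>"
    by (auto simp: S_def)
  have crit: "0 \<le> (\<Sum>i\<in>\<Lambda>. ?r S i) - (\<Sum>i\<in>\<Lambda>. ?r T i)
      + 2 * Pen \<Lambda> \<sigma> (restrict (indicator S) \<Lambda>) - 2 * Pen \<Lambda> \<sigma> (restrict (indicator T) \<Lambda>)"
    using min[OF S] unfolding criterion_eq[OF fin on] hx by linarith
  have termwise: "(1 - \<delta>) * (h x i * x i - f i)\<^sup>2 + ?r S i - ?r T i
      \<le> (if i \<in> S then (\<xi> i)\<^sup>2 / \<delta> else 0) + (if i \<in> T then 2 * (\<xi> i)\<^sup>2 else 0)"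
    if i: "i \<in> \<Lambda>" for i
  proof -
    consider "i \<in> T" "i \<in> S" | "i \<in> T" "i \<notin> S" | "i \<notin> T" "i \<notin> S" | "i \<notin> T" "i \<in> S"
      by blast
    then show ?thesis
    proof cases
      case 1
      have "(1 - \<delta>) * (\<xi> i)\<^sup>2 \<le> 1 * (\<xi> i)\<^sup>2"
        using \<delta> by (intro mult_right_mono) auto
      moreover have "0 \<le> (\<xi> i)\<^sup>2 / \<delta>"
        using \<delta> by simp
      moreover have "0 \<le> (\<xi> i)\<^sup>2"
        by simp
      moreover have "(1 - \<delta>) * (h x i * x i - f i)\<^sup>2 + ?r S i - ?r T i = (1 - \<delta>) * (\<xi> i)\<^sup>2"
        using 1 i by (simp add: hx x)
      ultimately have "(1 - \<delta>) * (h x i * x i - f i)\<^sup>2 + ?r S i - ?r T i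
          \<le> (\<xi> i)\<^sup>2 / \<delta> + 2 * (\<xi> i)\<^sup>2"
        by linarith
      then show ?thesis
        using 1 by simp
    next
      case 2
      then have f: "f i = 0"
        using i by (simp add: S_def)
      have "(1 - \<delta>) * (\<xi> i)\<^sup>2 \<le> 1 * (\<xi> i)\<^sup>2"
        using \<delta> by (intro mult_right_mono) auto
      with 2 i f show ?thesis
        by (simp add: hx x)
    next
      case 3
      then show ?thesis
        using i by (simp add: hx x S_def)
    next
      case 4
      have "0 \<le> (\<delta> * f i + \<xi> i)\<^sup>2 / \<delta> + (\<xi> i)\<^sup>2"
        using \<delta> by simp
      also have "\<dots> = \<delta> * (f i)\<^sup>2 + 2 * (f i * \<xi> i) + (\<xi> i)\<^sup>2 / \<delta> + (\<xi> i)\<^sup>2"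
        using \<delta> by (simp add: power2_eq_square field_simps)
      finally show ?thesis
        using 4 i by (simp add: hx x power2_eq_square algebra_simps)
    qed
  qed
  have "(1 - \<delta>) * (\<Sum>i\<in>\<Lambda>. (h x i * x i - f i)\<^sup>2) + (\<Sum>i\<in>\<Lambda>. ?r S i) - (\<Sum>i\<in>\<Lambda>. ?r T i)
      = (\<Sum>i\<in>\<Lambda>. (1 - \<delta>) * (h x i * x i - f i)\<^sup>2 + ?r S i - ?r T i)"
    by (simp add: sum.distrib sum_subtractf sum_distrib_left)
  also have "\<dots> \<le> (\<Sum>i\<in>\<Lambda>. (if i \<in> S then (\<xi> i)\<^sup>2 / \<delta> else 0) + (if i \<in> T then 2 * (\<xi> i)\<^sup>2 else 0))"
    using termwise by (rule sum_mono)
  also have "\<dots> = (\<Sum>i\<in>S. (\<xi> i)\<^sup>2) / \<delta> + 2 * (\<Sum>i\<in>T. (\<xi> i)\<^sup>2)"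
    using S T fin by (simp add: sum.distrib sum.If_cases Int_absorb1 sum_divide_distrib sum_distrib_left)
  finally have "(1 - \<delta>) * (\<Sum>i\<in>\<Lambda>. (h x i * x i - f i)\<^sup>2)
      \<le> 2 * Pen \<Lambda> \<sigma> (restrict (indicator S) \<Lambda>) + (\<Sum>i\<in>S. (\<xi> i)\<^sup>2) / \<delta>
        + 2 * ((\<Sum>i\<in>T. (\<xi> i)\<^sup>2) - Pen \<Lambda> \<sigma> (restrict (indicator T) \<Lambda>))"
    using crit by argo
  also have "\<dots> \<le> 2 * Pen \<Lambda> \<sigma> (restrict (indicator S) \<Lambda>) + (\<Sum>i\<in>S. (\<xi> i)\<^sup>2) / \<delta>
        + 2 * (diag_norm \<sigma> \<Lambda> * overshoot \<Lambda> c (\<lambda>i. (\<xi> i / \<sigma> i)\<^sup>2))"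
    using noise_energy_minus_Pen_le[of \<Lambda> T \<sigma> \<xi>] fin T pos by (simp add: c_def)
  finally show ?thesis
    unfolding L2_norm_f_hat_minus_series_power2[OF fin on] .
qed

lemma log_plus_nonneg: "0 \<le> log_plus z"
  by (simp add: log_plus_def)

lemma exp_minus_log_plus:
  assumes "0 < z"
  shows "exp (- log_plus z) = min (1 / z) 1"
  using assms by (auto simp: log_plus_def max_def min_def exp_minus ln_le_zero_iff field_simps)

lemma threshold_nonneg:
  assumes "j \<le> n" "0 \<le> L"
  shows "0 \<le> threshold n L j"
proof (cases "j = 0")
  case True
  then show ?thesis
    by (simp add: threshold_def)
next
  case False
  then show ?thesis
    using threshold_ge_2[of j n L] assms by simp
qed

lemma Pen_indicator_bounds:
  assumes fin: "finite \<Lambda>" and S: "S \<subseteq> \<Lambda>" and pos: "\<And>i. i \<in> \<Lambda> \<Longrightarrow> \<sigma> i > 0"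
  shows "0 \<le> Pen \<Lambda> \<sigma> (restrict (indicator S) \<Lambda>)"
    and "Pen \<Lambda> \<sigma> (restrict (indicator S) \<Lambda>) \<le> diag_norm \<sigma> S
      * (\<Sum>j = 1..card S. threshold (card \<Lambda>) (log_plus (real (card \<Lambda>) * diag_norm \<sigma> \<Lambda>)) j)"
proof -
  let ?c = "threshold (card \<Lambda>) (log_plus (real (card \<Lambda>) * diag_norm \<sigma> \<Lambda>))"
  obtain xs where xs: "distinct xs" "set xs = S"
    and ord: "\<And>j. j < length xs \<Longrightarrow>
      sigma2_ord \<Lambda> \<sigma> (restrict (indicator S) \<Lambda>) (Suc j) = (\<sigma> (xs ! j))\<^sup>2"
    using sigma2_ord_enumeration[of \<Lambda> S \<sigma>] fin S pos by metis
  have finS: "finite S"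
    using xs by auto
  have k: "card S = length xs"
    using xs distinct_card by blast
  have c: "0 \<le> ?c (Suc j)" if "j < card S" for j
    using that card_mono[OF fin S] by (intro threshold_nonneg log_plus_nonneg) auto
  show "0 \<le> Pen \<Lambda> \<sigma> (restrict (indicator S) \<Lambda>)"
    unfolding Pen_indicator_eq[OF S] using c ord k by (intro sum_nonneg) auto
  have "Pen \<Lambda> \<sigma> (restrict (indicator S) \<Lambda>) \<le> (\<Sum>j<card S. diag_norm \<sigma> S * ?c (Suc j))"
    unfolding Pen_indicator_eq[OF S]
  proof (rule sum_mono)
    fix j assume "j \<in> {..<card S}"
    then show "sigma2_ord \<Lambda> \<sigma> (restrict (indicator S) \<Lambda>) (Suc j) * ?c (Suc j) \<le> diag_norm \<sigma> S * ?c (Suc j)"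
      using c[of j] ord[of j] k xs diag_norm_ge[OF finS, of "xs ! j" \<sigma>]
      by (intro mult_right_mono) auto
  qed
  also have "\<dots> = diag_norm \<sigma> S * (\<Sum>j = 1..card S. ?c j)"
  proof -
    have "{1..card S} = Suc ` {..<card S}"
      by (simp add: image_Suc_lessThan)
    then show ?thesis
      by (simp add: sum.reindex sum_distrib_left)
  qed
  finally show "Pen \<Lambda> \<sigma> (restrict (indicator S) \<Lambda>) \<le> diag_norm \<sigma> S * (\<Sum>j = 1..card S. ?c j)" .
qed

lemma nn_integral_noise_square:
  assumes "finite \<Lambda>" "i \<in> \<Lambda>" "\<And>i. i \<in> \<Lambda> \<Longrightarrow> \<sigma> i > 0"
  shows "(\<integral>\<^sup>+\<xi>. ennreal ((\<xi> i)\<^sup>2) \<partial>noise \<Lambda> \<sigma>) = ennreal ((\<sigma> i)\<^sup>2)"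
  using nn_integral_noise_prod[of \<Lambda> "{i}" \<sigma> "\<lambda>_ z. ennreal (z\<^sup>2)"] assms
    nn_integral_square_normal[of "\<sigma> i"] by simp

text \<open>Integration of the pointwise bound. The factor \<open>diag_norm \<sigma> \<Lambda>\<close> times \<open>exp (- L)\<close>, with \<open>L\<close> the
logarithm in the penalty, is exactly the minimum on the right.\<close>

lemma oracle_risk_le:
  fixes f :: "'i \<Rightarrow> real"
  assumes fin: "finite \<Lambda>" and pos: "\<And>i. i \<in> \<Lambda> \<Longrightarrow> \<sigma> i > 0"
    and on: "orthonormal_system \<mu> \<Lambda> \<psi>"
    and sel: "penalized_selector \<mu> \<Lambda> \<psi> \<sigma> h"
    and \<delta>: "0 < \<delta>" "\<delta> < 1" and ne: "\<Lambda> \<noteq> {}"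
  defines "S \<equiv> {i \<in> \<Lambda>. f i \<noteq> 0}"
  shows "risk \<mu> \<Lambda> \<psi> \<sigma> h f
    \<le> (2 * Pen \<Lambda> \<sigma> (restrict (indicator S) \<Lambda>) + (\<Sum>i\<in>S. (\<sigma> i)\<^sup>2) / \<delta>
        + 11 / 2 * min (1 / real (card \<Lambda>)) (diag_norm \<sigma> \<Lambda>)) / (1 - \<delta>)"
proof -
  let ?M = "diag_norm \<sigma> \<Lambda>"
  let ?L = "log_plus (real (card \<Lambda>) * ?M)"
  let ?P = "Pen \<Lambda> \<sigma> (restrict (indicator S) \<Lambda>)"
  let ?V = "\<lambda>\<xi>. overshoot \<Lambda> (threshold (card \<Lambda>) ?L) (\<lambda>i. (\<xi> i / \<sigma> i)\<^sup>2)"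
  let ?loss = "\<lambda>\<xi>. (L2_norm \<mu> (\<lambda>t. f_hat \<Lambda> \<psi> (observation \<Lambda> f \<xi>) (h (observation \<Lambda> f \<xi>)) t
      - series \<Lambda> \<psi> f t))\<^sup>2"
  let ?B = "2 * ?P + (\<Sum>i\<in>S. (\<sigma> i)\<^sup>2) / \<delta> + 11 / 2 * min (1 / real (card \<Lambda>)) ?M"
  have S: "S \<subseteq> \<Lambda>" "finite S"
    using fin by (auto simp: S_def)
  have P: "0 \<le> ?P"
    by (rule Pen_indicator_bounds(1)[OF fin S(1) pos])
  have M: "0 < ?M"
  proof -
    obtain i where "i \<in> \<Lambda>"
      using ne by blast
    then have "0 < (\<sigma> i)\<^sup>2" "(\<sigma> i)\<^sup>2 \<le> ?M"
      using pos[of i] diag_norm_ge[OF fin] by auto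
    then show ?thesis
      by linarith
  qed
  have n: "0 < real (card \<Lambda>)"
    using fin ne by (simp add: card_gt_0_iff)
  have prob: "emeasure (noise \<Lambda> \<sigma>) (space (noise \<Lambda> \<sigma>)) = 1"
    using nn_integral_noise_prod[of \<Lambda> "{}" \<sigma> "\<lambda>_ _. 1"] fin pos by simp
  note comp = measurable_noise_component[of _ \<Lambda> \<sigma>]
  have exc: "(\<lambda>z. excess k c ((z / s)\<^sup>2)) \<in> borel_measurable borel" for k c s
    unfolding excess_def by measurable
  have V_meas [measurable]: "?V \<in> borel_measurable (noise \<Lambda> \<sigma>)"
    unfolding overshoot_def
    by (intro borel_measurable_sum borel_measurable_times borel_measurable_const
        borel_measurable_prod measurable_compose[OF comp exc]) auto
  have sq_meas [measurable]: "(\<lambda>\<xi>. (\<xi> i)\<^sup>2) \<in> borel_measurable (noise \<Lambda> \<sigma>)" if "i \<in> S" for i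
    using comp[of i] that S by (auto intro: borel_measurable_power)
  have u_meas [measurable]: "(\<lambda>\<xi>. \<Sum>i\<in>S. ennreal ((\<xi> i)\<^sup>2)) \<in> borel_measurable (noise \<Lambda> \<sigma>)"
    by (intro borel_measurable_sum measurable_compose[OF sq_meas measurable_ennreal])
  have "(\<integral>\<^sup>+\<xi>. (\<Sum>i\<in>S. ennreal ((\<xi> i)\<^sup>2)) \<partial>noise \<Lambda> \<sigma>)
      = (\<Sum>i\<in>S. \<integral>\<^sup>+\<xi>. ennreal ((\<xi> i)\<^sup>2) \<partial>noise \<Lambda> \<sigma>)"
    by (intro nn_integral_sum measurable_compose[OF sq_meas measurable_ennreal])
  also have "\<dots> = (\<Sum>i\<in>S. ennreal ((\<sigma> i)\<^sup>2))"
    using S(1) by (intro sum.cong nn_integral_noise_square[OF fin _ pos]) auto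
  finally have u_int: "(\<integral>\<^sup>+\<xi>. (\<Sum>i\<in>S. ennreal ((\<xi> i)\<^sup>2)) \<partial>noise \<Lambda> \<sigma>)
      = (\<Sum>i\<in>S. ennreal ((\<sigma> i)\<^sup>2))" .
  have split: "ennreal (a + (b * d + e * v))
      = ennreal a + (ennreal b * ennreal d + ennreal e * ennreal v)"
    if "0 \<le> a" "0 \<le> b" "0 \<le> d" "0 \<le> e" "0 \<le> v" for a b d e v :: real
    using that by (simp add: ennreal_plus ennreal_mult)
  \<comment> \<open>A bound for the extended nonnegative integral of the majorant bounds the Bochner integral of the loss.\<close>
  have "(\<integral>\<^sup>+\<xi>. ennreal ((1 - \<delta>) * ?loss \<xi>) \<partial>noise \<Lambda> \<sigma>)
      \<le> (\<integral>\<^sup>+\<xi>. ennreal (2 * ?P) + ((\<Sum>i\<in>S. ennreal ((\<xi> i)\<^sup>2)) * ennreal (1 / \<delta>)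
          + ennreal (2 * ?M) * ennreal (?V \<xi>)) \<partial>noise \<Lambda> \<sigma>)"
  proof (rule nn_integral_mono)
    fix \<xi> :: "'i \<Rightarrow> real"
    have "ennreal ((1 - \<delta>) * ?loss \<xi>)
        \<le> ennreal (2 * ?P + ((\<Sum>i\<in>S. (\<xi> i)\<^sup>2) * (1 / \<delta>) + 2 * ?M * ?V \<xi>))"
      using selected_loss_le[OF fin pos on sel \<delta>, of f \<xi>] by (intro ennreal_leI) (simp add: S_def)
    also have "\<dots> = ennreal (2 * ?P) + ((\<Sum>i\<in>S. ennreal ((\<xi> i)\<^sup>2)) * ennreal (1 / \<delta>)
          + ennreal (2 * ?M) * ennreal (?V \<xi>))"
      unfolding sum_ennreal[OF zero_le_power2]
      using P M \<delta> overshoot_nonneg[OF fin] by (intro split) (auto intro: sum_nonneg)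
    finally show "ennreal ((1 - \<delta>) * ?loss \<xi>)
        \<le> ennreal (2 * ?P) + ((\<Sum>i\<in>S. ennreal ((\<xi> i)\<^sup>2)) * ennreal (1 / \<delta>)
          + ennreal (2 * ?M) * ennreal (?V \<xi>))" .
  qed
  also have "\<dots> = ennreal (2 * ?P) + ((\<Sum>i\<in>S. ennreal ((\<sigma> i)\<^sup>2)) * ennreal (1 / \<delta>)
          + ennreal (2 * ?M) * (\<integral>\<^sup>+\<xi>. ennreal (?V \<xi>) \<partial>noise \<Lambda> \<sigma>))"
    using u_meas by (simp add: nn_integral_add nn_integral_multc nn_integral_cmult prob u_int
        del: sum_ennreal)
  also have "\<dots> \<le> ennreal (2 * ?P) + ((\<Sum>i\<in>S. ennreal ((\<sigma> i)\<^sup>2)) * ennreal (1 / \<delta>)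
          + ennreal (2 * ?M) * ennreal (11 / 4 * exp (- ?L)))"
    by (intro add_left_mono mult_left_mono nn_integral_overshoot_le[OF fin pos log_plus_nonneg]) auto
  also have "\<dots> = ennreal (2 * ?P + ((\<Sum>i\<in>S. (\<sigma> i)\<^sup>2) * (1 / \<delta>) + 2 * ?M * (11 / 4 * exp (- ?L))))"
    unfolding sum_ennreal[OF zero_le_power2]
    using P M \<delta> by (intro split[symmetric]) (auto intro: sum_nonneg)
  also have "2 * ?P + ((\<Sum>i\<in>S. (\<sigma> i)\<^sup>2) * (1 / \<delta>) + 2 * ?M * (11 / 4 * exp (- ?L))) = ?B"
  proof -
    have "?M * exp (- ?L) = min (1 / real (card \<Lambda>)) ?M"
      using M n by (subst exp_minus_log_plus) (auto simp: min_def field_simps)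
    then show ?thesis
      by simp
  qed
  finally have "(\<integral>\<xi>. (1 - \<delta>) * ?loss \<xi> \<partial>noise \<Lambda> \<sigma>) \<le> ?B"
    using P M \<delta> by (intro integral_real_bounded) (auto intro!: add_nonneg_nonneg divide_nonneg_pos sum_nonneg)
  then have "(1 - \<delta>) * risk \<mu> \<Lambda> \<psi> \<sigma> h f \<le> ?B"
    by (simp add: risk_def expect_def)
  then show ?thesis
    using \<delta> by (simp add: pos_le_divide_eq mult.commute)
qed

section \<open>Asymptotics over the sparsity class\<close>

lemma harmonic_sum_le:
  assumes "1 \<le> s"
  shows "(\<Sum>j = 1..s. 1 / real j) \<le> 1 + ln (real s)"
proof -
  obtain m where m: "s = Suc m"
    using assms by (cases s) auto
  have "harm (Suc m) - ln (Suc m) \<le> (harm (Suc 0) - ln (Suc 0) :: real)"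
    using decseqD[OF decseq_harm_diff_ln, of 0 m] by simp
  then show ?thesis
    by (simp add: m harm_def inverse_eq_divide)
qed

text \<open>Split \<open>ln (n * e / j)\<close> as \<open>ln (n / x) + 1 + ln (x / j)\<close>. The last parts add up to \<open>ln (x ^ s / fact s)\<close>, which
is at most \<open>x\<close> because \<open>x ^ s / fact s\<close> is one term of the exponential series.\<close>

lemma sum_threshold_le:
  assumes x: "real s \<le> x" "1 \<le> x" "x \<le> real n" and L: "0 \<le> L"
  shows "(\<Sum>j = 1..s. threshold n L j) \<le> 2 * (x * ln (real n / x) + 2 * x + (1 + ln x) * L)"
proof (cases "s = 0")
  case True
  then show ?thesis
    using x L by simp
next
  case False
  have eq: "threshold n L j = 2 * ((ln (real n / x) + 1) + ln (x / real j) + 1 / real j * L)"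
    if "j \<in> {1..s}" for j
  proof -
    have "ln (real n * exp 1 / real j) = ln ((real n / x) * (exp 1 * (x / real j)))"
      using x by simp
    also have "\<dots> = ln (real n / x) + 1 + ln (x / real j)"
      using x that by (subst ln_mult_pos | simp)+
    finally show ?thesis
      by (simp add: threshold_def)
  qed
  have "(\<Sum>j = 1..s. threshold n L j)
      = 2 * (real s * (ln (real n / x) + 1) + (\<Sum>j = 1..s. ln (x / real j)) + (\<Sum>j = 1..s. 1 / real j) * L)"
    using eq by (simp add: sum.distrib sum_distrib_left sum_distrib_right algebra_simps)
  moreover have "real s * (ln (real n / x) + 1) \<le> x * (ln (real n / x) + 1)"
    using x by (intro mult_right_mono) auto
  moreover have "(\<Sum>j = 1..s. ln (x / real j)) \<le> x"
  proof -
    have "(\<Sum>j = 1..s. ln (x / real j)) = ln (\<Prod>j = 1..s. x / real j)"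
      using x by (intro ln_prod[symmetric]) auto
    also have "(\<Prod>j = 1..s. x / real j) = x ^ s / fact s"
      by (simp add: prod_dividef fact_prod)
    also have "ln \<dots> \<le> ln (exp x)"
      using x power_over_fact_le_exp[of x s] by (intro ln_mono) auto
    finally show ?thesis
      by simp
  qed
  moreover have "(\<Sum>j = 1..s. 1 / real j) * L \<le> (1 + ln x) * L"
  proof (intro mult_right_mono L)
    have "ln (real s) \<le> ln x"
      using False x by (intro ln_mono) auto
    then show "(\<Sum>j = 1..s. 1 / real j) \<le> 1 + ln x"
      using harmonic_sum_le[of s] False by simp
  qed
  ultimately show ?thesis
    by (simp add: algebra_simps)
qed

text \<open>The choice \<open>\<delta> = 1 / sqrt l\<close> makes \<open>\<delta>\<close> vanish while the variance term \<open>x * D / \<delta> = x * D * sqrt l\<close> stays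
of smaller order than the main term \<open>x * D * l\<close>.\<close>

lemma sparse_risk_le:
  fixes f :: "'i \<Rightarrow> real" and \<gamma> :: real
  assumes fin: "finite \<Lambda>" and card: "card \<Lambda> = n" and pos: "\<And>i. i \<in> \<Lambda> \<Longrightarrow> \<sigma> i > 0"
    and on: "orthonormal_system \<mu> \<Lambda> \<psi>"
    and sel: "penalized_selector \<mu> \<Lambda> \<psi> \<sigma> h"
    and \<gamma>: "0 < \<gamma>" "1 < ln (1 / \<gamma>)" "1 < real n * \<gamma>"
    and f: "f \<in> sparse_class \<Lambda> \<gamma>"
  defines "l \<equiv> ln (1 / \<gamma>)" and "x \<equiv> real n * \<gamma>"
    and "M \<equiv> diag_norm \<sigma> \<Lambda>" and "D \<equiv> diag_norm \<sigma> (support \<Lambda> (nonzero_indicator f))"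
  shows "risk \<mu> \<Lambda> \<psi> \<sigma> h f
    \<le> 4 / (1 - 1 / sqrt l) * (1 + 2 / l + 1 / (4 * sqrt l) + 1 / ln x)
        * D * (x * l + ln x * log_plus (real n * M))
      + 11 / 2 / (1 - 1 / sqrt l) * min (1 / real n) M"
proof -
  define S where "S = {i \<in> \<Lambda>. f i \<noteq> 0}"
  let ?L = "log_plus (real n * M)"
  have supp: "support \<Lambda> (nonzero_indicator f) = S"
    by (auto simp: support_def nonzero_indicator_def S_def)
  have S: "S \<subseteq> \<Lambda>" "finite S"
    using fin by (auto simp: S_def)
  have l: "1 < l" and x: "1 < x" and n: "0 < real n"
    using \<gamma> by (auto simp: l_def x_def zero_less_mult_iff intro: gr0I)
  have sl: "1 < sqrt l" "sqrt l * sqrt l = l"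
    using l by auto
  have "\<gamma> < 1"
    using \<gamma> by (simp add: ln_div flip: ln_less_zero_iff)
  then have xn: "x \<le> real n"
    using n by (simp add: x_def mult_le_cancel_left1)
  have lx: "0 < ln x"
    using x by simp
  have nx: "real n / x = 1 / \<gamma>"
    using n by (simp add: x_def)
  have "(\<Sum>i\<in>\<Lambda>. of_bool (f i \<noteq> 0)) = real (card S)"
    using fin by (simp add: S_def of_bool_def sum.If_cases Int_def)
  then have s: "real (card S) \<le> x"
    using f by (simp add: sparse_class_def card x_def)
  have D: "0 \<le> D"
    unfolding D_def supp using S(2) by (rule diag_norm_nonneg)
  have M: "0 \<le> M"
    unfolding M_def using fin by (rule diag_norm_nonneg)
  have "Pen \<Lambda> \<sigma> (restrict (indicator S) \<Lambda>) \<le> D * (\<Sum>j = 1..card S. threshold n ?L j)"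
    using Pen_indicator_bounds(2)[of \<Lambda> S \<sigma>] fin S pos by (simp add: card D_def supp M_def)
  also have "\<dots> \<le> D * (2 * (x * l + 2 * x + (1 + ln x) * ?L))"
    using sum_threshold_le[OF s _ xn log_plus_nonneg, of "real n * M"] x D
    by (intro mult_left_mono) (auto simp: nx l_def)
  finally have pen: "Pen \<Lambda> \<sigma> (restrict (indicator S) \<Lambda>) \<le> D * (2 * (x * l + 2 * x + (1 + ln x) * ?L))" .
  have "(\<Sum>i\<in>S. (\<sigma> i)\<^sup>2) \<le> real (card S) * D"
    using S diag_norm_ge[OF S(2)] by (intro sum_bounded_above) (auto simp: D_def supp)
  also have "\<dots> \<le> x * D"
    using s D by (rule mult_right_mono)
  finally have var: "(\<Sum>i\<in>S. (\<sigma> i)\<^sup>2) \<le> x * D" .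
  let ?k = "1 + 2 / l + 1 / (4 * sqrt l) + 1 / ln x"
  have main: "x * l + 2 * x + (1 + ln x) * ?L + x * sqrt l / 4 \<le> ?k * (x * l + ln x * ?L)"
  proof -
    have "?k * (x * l + ln x * ?L) = (x * l + ln x * ?L) + (2 * x + x * sqrt l / 4 + ?L)
        + ((2 / l + 1 / (4 * sqrt l)) * (ln x * ?L) + x * l / ln x)"
    proof -
      have "(2 / l) * (x * l) = 2 * x" "1 / (4 * sqrt l) * (x * l) = x * sqrt l / 4"
          "1 / ln x * (ln x * ?L) = ?L"
        using l lx sl by (auto simp: field_simps)
      then show ?thesis
        by (simp add: distrib_right distrib_left)
    qed
    moreover have "0 \<le> (2 / l + 1 / (4 * sqrt l)) * (ln x * ?L) + x * l / ln x"
      using l lx x log_plus_nonneg by (intro add_nonneg_nonneg mult_nonneg_nonneg) auto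
    ultimately show ?thesis
      by (simp add: algebra_simps)
  qed
  have ne: "\<Lambda> \<noteq> {}"
    using n card by auto
  have split: "(4 * D * (k * y) + 11 / 2 * m) / e = 4 / e * k * D * y + 11 / 2 / e * m" for k y m e :: real
    by (simp add: add_divide_distrib mult_ac)
  have d: "0 < 1 / sqrt l" "1 / sqrt l < 1"
    using sl by auto
  have "risk \<mu> \<Lambda> \<psi> \<sigma> h f \<le> (2 * Pen \<Lambda> \<sigma> (restrict (indicator S) \<Lambda>)
      + (\<Sum>i\<in>S. (\<sigma> i)\<^sup>2) / (1 / sqrt l) + 11 / 2 * min (1 / real n) M) / (1 - 1 / sqrt l)"
    using ne oracle_risk_le[of \<Lambda> \<sigma> \<mu> \<psi> h "1 / sqrt l" f] fin pos on sel d n card by (auto simp: S_def M_def)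
  also have "\<dots> \<le> (4 * D * (?k * (x * l + ln x * ?L)) + 11 / 2 * min (1 / real n) M) / (1 - 1 / sqrt l)"
  proof (intro divide_right_mono add_mono order_refl)
    have div_inverse: "a / (1 / sqrt l) = a * sqrt l" for a
      by simp
    have "2 * Pen \<Lambda> \<sigma> (restrict (indicator S) \<Lambda>) + (\<Sum>i\<in>S. (\<sigma> i)\<^sup>2) / (1 / sqrt l)
        \<le> 2 * (D * (2 * (x * l + 2 * x + (1 + ln x) * ?L))) + (x * D) * sqrt l"
      unfolding div_inverse using l by (intro add_mono mult_left_mono[OF pen] mult_right_mono[OF var]) auto
    also have "\<dots> = 4 * D * (x * l + 2 * x + (1 + ln x) * ?L + x * sqrt l / 4)"
      by (simp add: algebra_simps)
    also have "\<dots> \<le> 4 * D * (?k * (x * l + ln x * ?L))"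
      using main D by (intro mult_left_mono) auto
    finally show "2 * Pen \<Lambda> \<sigma> (restrict (indicator S) \<Lambda>) + (\<Sum>i\<in>S. (\<sigma> i)\<^sup>2) / (1 / sqrt l)
        \<le> 4 * D * (?k * (x * l + ln x * ?L))" .
  qed (use d in auto)
  also have "\<dots> = 4 / (1 - 1 / sqrt l) * ?k * D * (x * l + ln x * ?L)
      + 11 / 2 / (1 - 1 / sqrt l) * min (1 / real n) M"
    by (rule split)
  finally show ?thesis .
qed

theorem theorem3p1:
  fixes \<mu> :: "'x measure"
    and \<Lambda> :: "nat \<Rightarrow> 'i set"
    and \<psi> :: "nat \<Rightarrow> 'i \<Rightarrow> 'x \<Rightarrow> real"
    and \<sigma> :: "nat \<Rightarrow> 'i \<Rightarrow> real"
    and \<gamma> :: "nat \<Rightarrow> real"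
    and hstar :: "nat \<Rightarrow> ('i \<Rightarrow> real) \<Rightarrow> ('i \<Rightarrow> real)"
  assumes "\<And>n. finite (\<Lambda> n)" and "\<And>n. card (\<Lambda> n) = n"
    and "\<And>n i. i \<in> \<Lambda> n \<Longrightarrow> \<sigma> n i > 0"
    and "\<And>n. orthonormal_system \<mu> (\<Lambda> n) (\<psi> n)"
    and "\<And>n. penalized_selector \<mu> (\<Lambda> n) (\<psi> n) (\<sigma> n) (hstar n)"
    and "\<And>n. 0 < \<gamma> n" and "\<And>n. \<gamma> n < 1"
    and "\<gamma> \<longlonglongrightarrow> 0"
    and "filterlim (\<lambda>n. real n * \<gamma> n) at_top sequentially"
  shows
    "(\<exists>\<epsilon>. \<epsilon> \<longlonglongrightarrow> 0 \<and>
        (\<forall>\<^sub>F n in sequentially. \<forall>f \<in> sparse_class (\<Lambda> n) (\<gamma> n).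
           risk \<mu> (\<Lambda> n) (\<psi> n) (\<sigma> n) (hstar n) f
             \<le> (4 + \<epsilon> n) * diag_norm (\<sigma> n) (support (\<Lambda> n) (nonzero_indicator f))
                 * (real n * \<gamma> n * ln (1 / \<gamma> n)
                    + ln (real n * \<gamma> n) * log_plus (real n * diag_norm (\<sigma> n) (\<Lambda> n)))
               + 4 * sqrt 2 * min (1 / real n) (diag_norm (\<sigma> n) (\<Lambda> n))))
     \<and>
     ((\<lambda>n. log_plus (diag_norm (\<sigma> n) (\<Lambda> n))) \<in> O(\<lambda>n. ln (real n)) \<longrightarrow>
      (\<forall>f :: nat \<Rightarrow> 'i \<Rightarrow> real.
         (\<forall>n. f n \<in> sparse_class (\<Lambda> n) (\<gamma> n)) \<longrightarrow>
         filterlim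
           (\<lambda>n. diag_norm (\<sigma> n) (support (\<Lambda> n) (nonzero_indicator (f n))) / diag_norm (\<sigma> n) (\<Lambda> n)
                * max (real n * diag_norm (\<sigma> n) (\<Lambda> n)) 1 * (real n * \<gamma> n * ln (1 / \<gamma> n)))
           at_top sequentially \<longrightarrow>
         (\<exists>\<epsilon>. \<epsilon> \<longlonglongrightarrow> 0 \<and>
            (\<forall>\<^sub>F n in sequentially.
               risk \<mu> (\<Lambda> n) (\<psi> n) (\<sigma> n) (hstar n) (f n)
                 \<le> (4 + \<epsilon> n) * diag_norm (\<sigma> n) (support (\<Lambda> n) (nonzero_indicator (f n)))
                     * (real n * \<gamma> n * ln (1 / \<gamma> n))))))"
proof (rule conjI)
  define l where "l n = ln (1 / \<gamma> n)" for n
  define x where "x n = real n * \<gamma> n" for n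
  define M where "M n = diag_norm (\<sigma> n) (\<Lambda> n)" for n
  define D where "D n f = diag_norm (\<sigma> n) (support (\<Lambda> n) (nonzero_indicator f))" for n and f :: "'i \<Rightarrow> real"
  let ?L = "\<lambda>n. log_plus (real n * M n)"
  let ?m = "\<lambda>n. min (1 / real n) (M n)"
  let ?risk = "\<lambda>n. risk \<mu> (\<Lambda> n) (\<psi> n) (\<sigma> n) (hstar n)"
  define \<epsilon> where "\<epsilon> n = 4 / (1 - 1 / sqrt (l n)) * (1 + 2 / l n + 1 / (4 * sqrt (l n)) + 1 / ln (x n)) - 4" for n
  have x_top: "filterlim x at_top sequentially"
    using assms(9) by (simp add: x_def [abs_def])
  have "filterlim (\<lambda>n. inverse (\<gamma> n)) at_top sequentially"
    using assms(6,8) by (intro filterlim_inverse_at_top) auto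
  then have l_top: "filterlim l at_top sequentially"
    unfolding l_def [abs_def] inverse_eq_divide by (rule filterlim_compose[OF ln_at_top])
  have \<epsilon>_lim: "\<epsilon> \<longlonglongrightarrow> 0"
  proof -
    have "((\<lambda>l. 4 / (1 - 1 / sqrt l)) \<longlongrightarrow> 4) at_top" "((\<lambda>l. 1 + 2 / l + 1 / (4 * sqrt l)) \<longlongrightarrow> 1) at_top"
      "((\<lambda>x::real. 1 / ln x) \<longlongrightarrow> 0) at_top"
      by real_asymp+
    note lims = filterlim_compose[OF this(1) l_top] filterlim_compose[OF this(2) l_top]
      filterlim_compose[OF this(3) x_top]
    have "\<epsilon> \<longlonglongrightarrow> 4 * (1 + 0) - 4"
      unfolding \<epsilon>_def by (intro tendsto_intros lims)
    then show ?thesis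
      by simp
  qed
  \<comment> \<open>The slack between \<open>11 / 2\<close> and \<open>4 * sqrt 2\<close> absorbs the division by \<open>1 - \<delta>\<close> in the remainder,
    which no multiple of \<open>D\<close> could absorb.\<close>
  have "((\<lambda>l. 11 / 2 / (1 - 1 / sqrt l)) \<longlongrightarrow> 11 / 2) at_top"
    by real_asymp
  then have "(\<lambda>n. 11 / 2 / (1 - 1 / sqrt (l n))) \<longlonglongrightarrow> 11 / 2"
    by (rule filterlim_compose[OF _ l_top])
  moreover have "11 / 2 < 4 * sqrt 2"
    using real_less_rsqrt[of "11 / 8" 2] by (simp add: power2_eq_square)
  ultimately have const: "\<forall>\<^sub>F n in sequentially. 11 / 2 / (1 - 1 / sqrt (l n)) < 4 * sqrt 2"
    by (rule order_tendstoD)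
  have l_gt: "\<forall>\<^sub>F n in sequentially. 1 < l n" and x_gt: "\<forall>\<^sub>F n in sequentially. 1 < x n"
    using l_top x_top by (auto simp: filterlim_at_top_dense)
  have bound: "\<forall>\<^sub>F n in sequentially. \<forall>f \<in> sparse_class (\<Lambda> n) (\<gamma> n).
      ?risk n f \<le> (4 + \<epsilon> n) * D n f * (x n * l n + ln (x n) * ?L n) + 4 * sqrt 2 * ?m n"
    using const l_gt x_gt
  proof eventually_elim
    case (elim n)
    show ?case
    proof
      fix f assume f: "f \<in> sparse_class (\<Lambda> n) (\<gamma> n)"
      have "?risk n f \<le> (4 + \<epsilon> n) * D n f * (x n * l n + ln (x n) * ?L n)
          + 11 / 2 / (1 - 1 / sqrt (l n)) * ?m n"
        using sparse_risk_le[OF assms(1-5) assms(6)[of n] _ _ f] elim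
        by (simp add: \<epsilon>_def l_def x_def D_def M_def)
      also have "\<dots> \<le> (4 + \<epsilon> n) * D n f * (x n * l n + ln (x n) * ?L n) + 4 * sqrt 2 * ?m n"
        using elim diag_norm_nonneg[OF assms(1)]
        by (intro add_left_mono mult_right_mono) (auto simp: M_def)
      finally show "?risk n f \<le> (4 + \<epsilon> n) * D n f * (x n * l n + ln (x n) * ?L n) + 4 * sqrt 2 * ?m n" .
    qed
  qed
  show "\<exists>\<epsilon>. \<epsilon> \<longlonglongrightarrow> 0 \<and>
        (\<forall>\<^sub>F n in sequentially. \<forall>f \<in> sparse_class (\<Lambda> n) (\<gamma> n).
           risk \<mu> (\<Lambda> n) (\<psi> n) (\<sigma> n) (hstar n) f
             \<le> (4 + \<epsilon> n) * diag_norm (\<sigma> n) (support (\<Lambda> n) (nonzero_indicator f))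
                 * (real n * \<gamma> n * ln (1 / \<gamma> n)
                    + ln (real n * \<gamma> n) * log_plus (real n * diag_norm (\<sigma> n) (\<Lambda> n)))
               + 4 * sqrt 2 * min (1 / real n) (diag_norm (\<sigma> n) (\<Lambda> n)))"
    using \<epsilon>_lim bound unfolding l_def x_def M_def D_def by blast
  show "(\<lambda>n. log_plus (diag_norm (\<sigma> n) (\<Lambda> n))) \<in> O(\<lambda>n. ln (real n)) \<longrightarrow>
      (\<forall>f :: nat \<Rightarrow> 'i \<Rightarrow> real.
         (\<forall>n. f n \<in> sparse_class (\<Lambda> n) (\<gamma> n)) \<longrightarrow>
         filterlim
           (\<lambda>n. diag_norm (\<sigma> n) (support (\<Lambda> n) (nonzero_indicator (f n))) / diag_norm (\<sigma> n) (\<Lambda> n)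
                * max (real n * diag_norm (\<sigma> n) (\<Lambda> n)) 1 * (real n * \<gamma> n * ln (1 / \<gamma> n)))
           at_top sequentially \<longrightarrow>
         (\<exists>\<epsilon>. \<epsilon> \<longlonglongrightarrow> 0 \<and>
            (\<forall>\<^sub>F n in sequentially.
               risk \<mu> (\<Lambda> n) (\<psi> n) (\<sigma> n) (hstar n) (f n)
                 \<le> (4 + \<epsilon> n) * diag_norm (\<sigma> n) (support (\<Lambda> n) (nonzero_indicator (f n)))
                     * (real n * \<gamma> n * ln (1 / \<gamma> n)))))"
    unfolding l_def[symmetric] x_def[symmetric] M_def[symmetric] D_def[symmetric]
  proof (intro impI allI)
    fix f :: "nat \<Rightarrow> 'i \<Rightarrow> real"
    assume O: "(\<lambda>n. log_plus (M n)) \<in> O(\<lambda>n. ln (real n))"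
      and f: "\<forall>n. f n \<in> sparse_class (\<Lambda> n) (\<gamma> n)"
      and top: "filterlim (\<lambda>n. D n (f n) / M n * max (real n * M n) 1 * (x n * l n)) at_top sequentially"
    \<comment> \<open>\<open>?r\<close> is the second logarithmic term relative to the first, and \<open>inverse ?t\<close> is the
      remainder relative to the main term.\<close>
    let ?r = "\<lambda>n. ln (x n) * ?L n / (x n * l n)"
    let ?t = "\<lambda>n. D n (f n) / M n * max (real n * M n) 1 * (x n * l n)"
    define \<epsilon>' where "\<epsilon>' n = (4 + \<epsilon> n) * (1 + ?r n) + 4 * sqrt 2 * inverse (?t n) - 4" for n
    obtain K where K: "\<forall>\<^sub>F n in sequentially. norm (log_plus (M n)) \<le> K * norm (ln (real n))"
      using O by (auto elim: landau_o.bigE)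
    have M_nonneg: "0 \<le> M n" for n
      unfolding M_def using assms(1) by (rule diag_norm_nonneg)
    have r_bounds: "\<forall>\<^sub>F n in sequentially.
        0 \<le> ?r n \<and> ?r n \<le> (1 + K) * ((ln (x n))\<^sup>2 / x n * (1 / l n) + ln (x n) / x n)"
      using K l_gt x_gt
    proof eventually_elim
      case (elim n)
      have n: "1 \<le> real n"
        using elim by (cases n) (auto simp: x_def)
      \<comment> \<open>\<open>ln n\<close> is the sum of \<open>ln (x n)\<close> and \<open>l n\<close>, so \<open>ln (x n) * ln n\<close> is small against
        \<open>x n * l n\<close>.\<close>
      have "ln (real n) = ln (x n * (1 / \<gamma> n))"
        using assms(6)[of n] by (simp add: x_def)
      also have "\<dots> = ln (x n) + l n"
        using assms(6)[of n] elim by (subst ln_mult_pos) (auto simp: l_def)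
      finally have ln_n: "ln (real n) = ln (x n) + l n" .
      have lx: "0 < ln (x n)"
        using elim by simp
      have "?L n \<le> ln (real n) + log_plus (M n)"
      proof (cases "M n = 0")
        case True
        then show ?thesis
          using n by (simp add: log_plus_def)
      next
        case False
        then have "0 < M n"
          using M_nonneg[of n] by simp
        then show ?thesis
          using n by (simp add: log_plus_def ln_mult_pos)
      qed
      also have "\<dots> \<le> (1 + K) * ln (real n)"
        using elim n by (simp add: log_plus_nonneg algebra_simps)
      finally have "?L n \<le> (1 + K) * (ln (x n) + l n)"
        by (simp add: ln_n)
      then have "?r n \<le> ln (x n) * ((1 + K) * (ln (x n) + l n)) / (x n * l n)"
        using elim lx by (intro divide_right_mono mult_left_mono) auto
      also have "\<dots> = (1 + K) * ((ln (x n))\<^sup>2 / x n * (1 / l n) + ln (x n) / x n)"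
        using elim by (simp add: field_simps power2_eq_square)
      finally show ?case
        using elim lx log_plus_nonneg by auto
    qed
    have r_lim: "?r \<longlonglongrightarrow> 0"
    proof (rule tendsto_sandwich)
      show "\<forall>\<^sub>F n in sequentially. 0 \<le> ?r n"
        "\<forall>\<^sub>F n in sequentially. ?r n \<le> (1 + K) * ((ln (x n))\<^sup>2 / x n * (1 / l n) + ln (x n) / x n)"
        using r_bounds by (auto elim: eventually_mono)
      have "((\<lambda>x::real. (ln x)\<^sup>2 / x) \<longlongrightarrow> 0) at_top" "((\<lambda>x::real. ln x / x) \<longlongrightarrow> 0) at_top"
        "((\<lambda>l::real. 1 / l) \<longlongrightarrow> 0) at_top"
        by real_asymp+
      note lims = filterlim_compose[OF this(1) x_top] filterlim_compose[OF this(2) x_top]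
        filterlim_compose[OF this(3) l_top]
      have "(\<lambda>n. (1 + K) * ((ln (x n))\<^sup>2 / x n * (1 / l n) + ln (x n) / x n)) \<longlonglongrightarrow> (1 + K) * (0 * 0 + 0)"
        by (intro tendsto_intros lims)
      then show "(\<lambda>n. (1 + K) * ((ln (x n))\<^sup>2 / x n * (1 / l n) + ln (x n) / x n)) \<longlonglongrightarrow> 0"
        by simp
    qed simp
    have "\<epsilon>' \<longlonglongrightarrow> (4 + 0) * (1 + 0) + 4 * sqrt 2 * 0 - 4"
      unfolding \<epsilon>'_def
      by (intro tendsto_intros \<epsilon>_lim r_lim tendsto_inverse_0_at_top[OF top])
    moreover have "\<forall>\<^sub>F n in sequentially. ?risk n (f n) \<le> (4 + \<epsilon>' n) * D n (f n) * (x n * l n)"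
      using bound l_gt x_gt filterlim_at_top_dense[THEN iffD1, OF top, rule_format, of 0]
    proof eventually_elim
      case (elim n)
      have n: "0 < real n"
        using elim by (cases n) (auto simp: x_def)
      have pos: "0 < M n" "D n (f n) \<noteq> 0"
        using elim M_nonneg[of n] by (auto simp: less_le)
      have m: "?m n = M n / max (real n * M n) 1"
        using pos n by (auto simp: min_def max_def field_simps)
      have collect: "a * d * ((1 + r) * y) + q * (i * d * y) = (4 + (a * (1 + r) + q * i - 4)) * d * y"
        for a d r y q i :: real
        by (simp add: algebra_simps)
      have "?m n = inverse (?t n) * D n (f n) * (x n * l n)"
        unfolding m using pos elim by (simp add: field_simps)
      moreover have "x n * l n + ln (x n) * ?L n = (1 + ?r n) * (x n * l n)"
        using elim by (simp add: field_simps)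
      ultimately have "(4 + \<epsilon> n) * D n (f n) * (x n * l n + ln (x n) * ?L n) + 4 * sqrt 2 * ?m n
          = (4 + \<epsilon>' n) * D n (f n) * (x n * l n)"
        unfolding \<epsilon>'_def by (simp only: collect)
      then show ?case
        using elim f by metis
    qed
    ultimately show "\<exists>\<epsilon>. \<epsilon> \<longlonglongrightarrow> 0 \<and>
        (\<forall>\<^sub>F n in sequentially. ?risk n (f n) \<le> (4 + \<epsilon> n) * D n (f n) * (x n * l n))"
      by auto
  qed
qed

end
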